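(* Let $f$ be a Hamiltonian stationary torus (setting in context). A multiplier $h\in\mathrm{Spec}$ of a holomorphic section determines a unique pair $(A,B)\in\mathbb C^2$, up to translation of $B$ by the dual lattice $\Gamma^*$, with $h^{A,B}=h$. Moreover, the set of multipliers of $f$ is $$\mathrm{Spec}=\{h^{A,B}\mid \Gamma^*_{A,B}\ne\varnothing\}.$$ In fact, for all $\delta\in\Gamma^*_{A,B}$ there exists a complex one-dimensional subspace $\mathcal L_{A,\delta-B}$ of the space $H^0_{A,B}:=H^0_{h^{A,B}}$ of holomorphic sections with multiplier $h^{A,B}$.
   Context: Identify $\mathbb R^4$ with $\mathbb H$ and $\mathbb C$ with $\mathrm{span}_{\mathbb R}\{1,i\}$; $\langle\cdot,\cdot\rangle$ is the Euclidean inner product on $\mathbb C\cong\mathbb R^2$. $\Gamma\subset\mathbb C$ a lattice, $\Gamma^*=\{\delta:\langle\delta,\gamma\rangle\in\mathbb Z\ \forall\gamma\in\Gamma\}$. A Hamiltonian stationary torus is a $\Gamma$-periodic conformal immersion $f:\mathbb C\to\mathbb H$ with $df=e^{j\beta/2}dz\,g$, $dz=dx+i\,dy$, $g$ nowhere zero, $\beta(z)=2\pi\langle\beta_0,z\rangle$ with $0\ne\beta_0\in\Gamma^*$. Convention $*dz=i\,dz$; left normal $N=e^{j\beta}i$. A map $\alpha:\mathbb C\to\mathbb H$ is holomorphic if $*d\alpha=N\,d\alpha$. For a homomorphism $h:\Gamma\to\mathbb C_*$, $H^0_h$ is the complex vector space (scalars on the right) of holomorphic $\alpha$ with $\alpha(z+\gamma)=\alpha(z)h(\gamma)$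 for all $\gamma\in\Gamma$, and $\mathrm{Spec}=\{h:H^0_h\ne0\}$. For $(A,B)\in\mathbb C^2$, $h^{A,B}(\gamma)=e^{2\pi(\langle A,\gamma\rangle-i\langle B,\gamma\rangle)}$, and $\Gamma^*_{A,B}=\{\delta\in\Gamma^*+\frac{\beta_0}2:\ |\delta-B|^2-|A|^2=\frac{|\beta_0|^2}4,\ \langle\delta-B,A\rangle=0\}$. *)

theory Defs
  imports "HOL-Analysis.Analysis"
begin

text \<open>A quaternion is represented as a pair (a, b) of complex numbers standing for
  a + b j, where C = span{1,i} sits inside H and j z = cnj z j.  The underlying
  real vector space complex \<times> complex is R^4 with the Euclidean norm.\<close>

type_synonym quat = "complex \<times> complex"

definition qmul :: "quat \<Rightarrow> quat \<Rightarrow> quat" where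
  "qmul p q = (fst p * fst q - snd p * cnj (snd q), fst p * snd q + snd p * cnj (fst q))"

definition cq :: "complex \<Rightarrow> quat" where
  "cq c = (c, 0)"

definition qj :: quat where "qj = (0, 1)"

definition qi :: quat where "qi = (\<i>, 0)"

definition qexpj :: "real \<Rightarrow> quat" where
  "qexpj t = (complex_of_real (cos t), complex_of_real (sin t))"

definition lattice :: "complex set \<Rightarrow> bool" where
  "lattice \<Gamma> \<longleftrightarrow> (\<exists>\<omega>1 \<omega>2. Im (cnj \<omega>1 * \<omega>2) \<noteq> 0 \<and>
      \<Gamma> = {of_int m * \<omega>1 + of_int n * \<omega>2 | m n. True})"

definition dual_lattice :: "complex set \<Rightarrow> complex set" where
  "dual_lattice \<Gamma> = {\<delta>. \<forall>\<gamma>\<in>\<Gamma>. \<delta> \<bullet> \<gamma> \<in> \<int>}"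

definition beta_fun :: "complex \<Rightarrow> complex \<Rightarrow> real" where
  "beta_fun \<beta>0 z = 2 * pi * (\<beta>0 \<bullet> z)"

definition HS_torus :: "complex set \<Rightarrow> complex \<Rightarrow> (complex \<Rightarrow> quat) \<Rightarrow> bool" where
  "HS_torus \<Gamma> \<beta>0 f \<longleftrightarrow>
     lattice \<Gamma> \<and> \<beta>0 \<in> dual_lattice \<Gamma> \<and> \<beta>0 \<noteq> 0 \<and>
     (\<forall>z. \<forall>\<gamma>\<in>\<Gamma>. f (z + \<gamma>) = f z) \<and>
     (\<exists>g :: complex \<Rightarrow> quat. (\<forall>z. g z \<noteq> 0) \<and>
        (\<forall>z. (f has_derivative
               (\<lambda>v. qmul (qexpj (beta_fun \<beta>0 z / 2)) (qmul (cq v) (g z)))) (at z)))"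

definition normalN :: "complex \<Rightarrow> complex \<Rightarrow> quat" where
  "normalN \<beta>0 z = qmul (qexpj (beta_fun \<beta>0 z)) qi"

text \<open>holomorphic: *d\<alpha> = N d\<alpha>, where (*\<omega>)(v) = \<omega>(i v) (so that *dz = i dz)\<close>
definition holomorphic_q :: "complex \<Rightarrow> (complex \<Rightarrow> quat) \<Rightarrow> bool" where
  "holomorphic_q \<beta>0 \<alpha> \<longleftrightarrow>
     (\<exists>D. \<forall>z. (\<alpha> has_derivative D z) (at z) \<and>
            (\<forall>v. D z (\<i> * v) = qmul (normalN \<beta>0 z) (D z v)))"

definition lattice_hom :: "complex set \<Rightarrow> (complex \<Rightarrow> complex) \<Rightarrow> bool" where
  "lattice_hom \<Gamma> h \<longleftrightarrow>
     (\<forall>\<gamma>\<in>\<Gamma>. h \<gamma> \<noteq> 0) \<and> (\<forall>\<gamma>1\<in>\<Gamma>. \<forall>\<gamma>2\<in>\<Gamma>. h (\<gamma>1 + \<gamma>2) = h \<gamma>1 * h \<gamma>2)"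

text \<open>H^0_h (complex structure: scalars acting on the right)\<close>
definition H0 :: "complex set \<Rightarrow> complex \<Rightarrow> (complex \<Rightarrow> complex) \<Rightarrow> (complex \<Rightarrow> quat) set" where
  "H0 \<Gamma> \<beta>0 h = {\<alpha>. holomorphic_q \<beta>0 \<alpha> \<and>
       (\<forall>z. \<forall>\<gamma>\<in>\<Gamma>. \<alpha> (z + \<gamma>) = qmul (\<alpha> z) (cq (h \<gamma>)))}"

definition in_Spec :: "complex set \<Rightarrow> complex \<Rightarrow> (complex \<Rightarrow> complex) \<Rightarrow> bool" where
  "in_Spec \<Gamma> \<beta>0 h \<longleftrightarrow> lattice_hom \<Gamma> h \<and> (\<exists>\<alpha>\<in>H0 \<Gamma> \<beta>0 h. \<alpha> \<noteq> (\<lambda>_. 0))"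

definition hAB :: "complex \<Rightarrow> complex \<Rightarrow> complex \<Rightarrow> complex" where
  "hAB A B \<gamma> = exp (complex_of_real (2 * pi * (A \<bullet> \<gamma>)) - \<i> * complex_of_real (2 * pi * (B \<bullet> \<gamma>)))"

definition dual_AB :: "complex set \<Rightarrow> complex \<Rightarrow> complex \<Rightarrow> complex \<Rightarrow> complex set" where
  "dual_AB \<Gamma> \<beta>0 A B = {\<delta>. \<delta> \<in> (\<lambda>d. d + \<beta>0 / 2) ` dual_lattice \<Gamma> \<and>
       (cmod (\<delta> - B))\<^sup>2 - (cmod A)\<^sup>2 = (cmod \<beta>0)\<^sup>2 / 4 \<and> (\<delta> - B) \<bullet> A = 0}"

definition one_dim_subspace :: "(complex \<Rightarrow> quat) set \<Rightarrow> bool" where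
  "one_dim_subspace L \<longleftrightarrow> (\<exists>\<alpha>. \<alpha> \<noteq> (\<lambda>_. 0) \<and> L = {(\<lambda>z. qmul (\<alpha> z) (cq c)) | c. True})"

end

theory Submission
  imports Defs
begin

text \<open>Writing a holomorphic section as \<open>\<alpha> = e\<^sup>j\<^sup>\<beta>\<^sup>/\<^sup>2 (u + j v)\<close> turns \<open>*d\<alpha> = N d\<alpha>\<close> into a first
  order system for the complex functions \<open>u\<close>, \<open>v\<close> with constant coefficients, coupling the
  antiholomorphic derivative of \<open>u\<close> to \<open>v\<close> and the holomorphic derivative of \<open>v\<close> to \<open>u\<close>.
  On an exponential of frequency \<open>\<delta> - B\<close> and growth \<open>A\<close> it becomes a 2 by 2 linear system, which is
  singular exactly when \<open>\<delta> \<in> \<Gamma>\<^sup>*\<^sub>A\<^sub>,\<^sub>B\<close>. A singular frequency yields a section. Conversely, if there is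
  none, then all Fourier coefficients of \<open>u\<close> and \<open>v\<close> vanish. Since \<open>\<alpha>\<close> is only assumed to be
  differentiable at each point, the integration by parts for the coefficients rests on a divergence
  theorem without continuity of the partial derivatives, obtained by bisection as in Goursat's lemma.\<close>

section \<open>Divergence theorem for pointwise differentiable functions\<close>

text \<open>Goursat's bisection. If the ratio of \<open>norm (F x y r)\<close> to the area
  \<open>r\<^sup>2\<close> were some \<open>K > 0\<close>, one of the four quarters would again have
  ratio at least \<open>K\<close>. Repetition gives nested squares shrinking to a point, near which
  \<open>small\<close> pushes the ratio down to \<open>K/2\<close>.\<close>

lemma squares_additive_eq_0:
  fixes F :: "real \<Rightarrow> real \<Rightarrow> real \<Rightarrow> 'a::real_normed_vector"
  assumes split: "\<And>x y r. r > 0 \<Longrightarrow> F x y r = F x y (r/2) + F (x+r/2) y (r/2)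
                     + F x (y+r/2) (r/2) + F (x+r/2) (y+r/2) (r/2)"
    and small: "\<And>z e. e > 0 \<Longrightarrow> \<exists>d>0. \<forall>x y r. 0 < r \<and> r < d \<and> z \<in> cbox (x,y) (x+r,y+r)
                     \<longrightarrow> norm (F x y r) \<le> e * r\<^sup>2"
    and r: "r > 0"
  shows "F x y r = 0"
proof (rule ccontr)
  assume "F x y r \<noteq> 0"
  define K where "K = norm (F x y r) / r\<^sup>2"
  have K: "K > 0" using \<open>F x y r \<noteq> 0\<close> r by (simp add: K_def)
  let ?P = "\<lambda>n p. norm (F (fst p) (snd p) (r/2^n)) \<ge> K * (r/2^n)\<^sup>2"
  \<comment> \<open>Nesting of consecutive squares, given by their lower left corners; it makes the
    sets \<open>C n\<close> below decreasing.\<close>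
  let ?Q = "\<lambda>n p p'. fst p \<le> fst p' \<and> snd p \<le> snd p' \<and>
               fst p' + r/2^Suc n \<le> fst p + r/2^n \<and> snd p' + r/2^Suc n \<le> snd p + r/2^n"
  have "\<exists>p. \<forall>n. ?P n (p n) \<and> ?Q n (p n) (p (Suc n))"
  proof (rule dependent_nat_choice)
    show "\<exists>p. ?P 0 p" by (rule exI[of _ "(x,y)"]) (use r in \<open>simp add: K_def\<close>)
  next
    fix p n assume P: "?P n p"
    obtain a b where p: "p = (a,b)" by force
    define \<rho> where "\<rho> = r/2^n"
    have \<rho>: "\<rho> > 0" "r / 2^Suc n = \<rho>/2" using r by (auto simp: \<rho>_def)
    have "K * \<rho>\<^sup>2 \<le> norm (F a b \<rho>)" using P p by (simp add: \<rho>_def)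
    also have "\<dots> \<le> norm (F a b (\<rho>/2)) + norm (F (a+\<rho>/2) b (\<rho>/2))
                 + norm (F a (b+\<rho>/2) (\<rho>/2)) + norm (F (a+\<rho>/2) (b+\<rho>/2) (\<rho>/2))"
      unfolding split[OF \<rho>(1), of a b]
      by (intro norm_triangle_le add_mono) auto
    \<comment> \<open>Pigeonhole: four times \<open>K * (\<rho>/2)\<^sup>2\<close> is
      \<open>K * \<rho>\<^sup>2\<close>, so the bound cannot fail on all four quarters.\<close>
    finally have "K * (\<rho>/2)\<^sup>2 \<le> norm (F a b (\<rho>/2)) \<or> K * (\<rho>/2)\<^sup>2 \<le> norm (F (a+\<rho>/2) b (\<rho>/2))
       \<or> K * (\<rho>/2)\<^sup>2 \<le> norm (F a (b+\<rho>/2) (\<rho>/2)) \<or> K * (\<rho>/2)\<^sup>2 \<le> norm (F (a+\<rho>/2) (b+\<rho>/2) (\<rho>/2))"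
      by (simp add: power_divide) linarith
    then obtain p' where p': "p' \<in> {(a,b),(a+\<rho>/2,b),(a,b+\<rho>/2),(a+\<rho>/2,b+\<rho>/2)}"
        "K * (\<rho>/2)\<^sup>2 \<le> norm (F (fst p') (snd p') (\<rho>/2))" by fastforce
    have "?Q n p p'" using p'(1) \<rho> unfolding \<rho>(2) \<rho>_def[symmetric] p by auto
    then show "\<exists>p'. ?P (Suc n) p' \<and> ?Q n p p'" using p'(2) unfolding \<rho>(2) by blast
  qed
  then obtain p where p: "\<And>n. ?P n (p n)" "\<And>n. ?Q n (p n) (p (Suc n))" by blast
  define C where "C n = cbox (p n) (fst (p n) + r/2^n, snd (p n) + r/2^n)" for n
  have Cs: "C (Suc n) \<subseteq> C n" for n
    unfolding C_def using p(2)[of n]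
    by (cases "p n"; cases "p (Suc n)") (auto simp: cbox_Pair_eq subset_iff)
  have "\<Inter>(range C) \<noteq> {}"
  proof (rule compact_nest)
    show "compact (C n)" for n by (simp add: C_def)
    show "C n \<noteq> {}" for n using r by (cases "p n") (auto simp: C_def cbox_Pair_eq)
    show "C n \<subseteq> C m" if "m \<le> n" for m n
      using that by (rule lift_Suc_antimono_le[where f=C, rotated]) (rule Cs)
  qed
  then obtain z where z: "\<And>n. z \<in> C n" by blast
  from small[of "K/2" z] K obtain d where d: "d > 0"
    "\<And>x y r. 0 < r \<Longrightarrow> r < d \<Longrightarrow> z \<in> cbox (x,y) (x+r,y+r) \<Longrightarrow> norm (F x y r) \<le> K/2 * r\<^sup>2"
    by (metis half_gt_zero)
  have "(\<lambda>n. r * (1/2)^n) \<longlonglongrightarrow> r * 0" by (intro tendsto_intros LIMSEQ_power_zero) auto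
  then have "\<forall>\<^sub>F n in sequentially. r * (1/2)^n < d" using d(1) by (intro order_tendstoD) auto
  then obtain n where n: "r / 2^n < d" by (auto simp: eventually_sequentially power_divide)
  have "norm (F (fst (p n)) (snd (p n)) (r/2^n)) \<le> K/2 * (r/2^n)\<^sup>2"
    using z[of n] n r by (intro d(2)) (auto simp: C_def)
  with p(1)[of n] have "K * (r/2^n)\<^sup>2 \<le> K/2 * (r/2^n)\<^sup>2" by linarith
  with K r show False by (simp add: mult_le_cancel_right)
qed

lemma integral_split_square:
  fixes G :: "real \<times> real \<Rightarrow> complex"
  assumes G: "continuous_on UNIV G" and "r > 0"
  shows "integral (cbox (x,y) (x+r,y+r)) G =
     integral (cbox (x,y) (x+r/2,y+r/2)) G + integral (cbox (x+r/2,y) (x+r,y+r/2)) G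
     + integral (cbox (x,y+r/2) (x+r/2,y+r)) G + integral (cbox (x+r/2,y+r/2) (x+r,y+r)) G"
proof -
  have int: "G integrable_on cbox a b" for a b
    by (rule integrable_continuous) (rule continuous_on_subset[OF G], simp)
  have h: "integral (cbox (a,b) (c,d)) G
      = integral (cbox (a,b) (e,d)) G + integral (cbox (e,b) (c,d)) G" if "a \<le> e" "e \<le> c" for a b c d e
  proof -
    have "cbox (a,b) (c,d) \<inter> {x. x \<bullet> (1,0) \<le> e} = cbox (a,b) (e,d)"
      "cbox (a,b) (c,d) \<inter> {x. x \<bullet> (1,0) \<ge> e} = cbox (e,b) (c,d)"
      using that by (auto simp: cbox_Pair_eq)
    with integral_split[OF int, of "(1,0)" "(a,b)" "(c,d)" e] show ?thesis by (simp add: Basis_prod_def)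
  qed
  have v: "integral (cbox (a,b) (c,d)) G
      = integral (cbox (a,b) (c,e)) G + integral (cbox (a,e) (c,d)) G" if "b \<le> e" "e \<le> d" for a b c d e
  proof -
    have "cbox (a,b) (c,d) \<inter> {x. x \<bullet> (0,1) \<le> e} = cbox (a,b) (c,e)"
      "cbox (a,b) (c,d) \<inter> {x. x \<bullet> (0,1) \<ge> e} = cbox (a,e) (c,d)"
      using that by (auto simp: cbox_Pair_eq)
    with integral_split[OF int, of "(0,1)" "(a,b)" "(c,d)" e] show ?thesis by (simp add: Basis_prod_def)
  qed
  show ?thesis
    using \<open>r > 0\<close> h[of x "x+r/2" "x+r" y "y+r"] v[of y "y+r/2" "y+r" x "x+r/2"]
      v[of y "y+r/2" "y+r" "x+r/2" "x+r"]
    by simp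
qed

lemma integral_bound_const:
  fixes f :: "real \<Rightarrow> complex"
  assumes "a \<le> b" "continuous_on {a..b} f" "\<And>t. t \<in> {a..b} \<Longrightarrow> norm (f t - c) \<le> e"
  shows "norm (integral {a..b} f - (b-a) *\<^sub>R c) \<le> e * (b-a)"
proof -
  have "integral {a..b} (\<lambda>t. f t - c) = integral {a..b} f - (b-a) *\<^sub>R c"
    using assms by (subst integral_diff) (auto intro: integrable_continuous_real)
  moreover have "norm (integral {a..b} (\<lambda>t. f t - c)) \<le> e * (b-a)"
    using assms by (intro integral_bound continuous_intros) auto
  ultimately show ?thesis by simp
qed

text \<open>Continuity is available for the combination \<open>G\<close>, not for the partial
  derivatives separately, so the edges cannot be handled by integrating each partial derivative.
  Instead, boundary flux minus area integral is additive under bisection, because inner edges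
  cancel, and differentiability at a point makes it small against the area of squares around that
  point.\<close>

lemma divergence_square:
  fixes W :: "real \<times> real \<Rightarrow> complex"
  assumes W: "\<And>z. (W has_derivative L z) (at z)"
    and eq: "\<And>z. p * L z (1,0) + q * L z (0,1) = G z"
    and G: "continuous_on UNIV G" and r: "r > 0"
  shows "integral (cbox (x,y) (x+r,y+r)) G =
     p * integral {y..y+r} (\<lambda>t. W (x+r,t) - W (x,t))
     + q * integral {x..x+r} (\<lambda>s. W (s,y+r) - W (s,y))"
proof -
  have Wc: "continuous_on UNIV W"
    using W by (meson continuous_at_imp_continuous_on has_derivative_continuous)
  have cont: "continuous_on S (\<lambda>t. W (f t))" if "continuous_on S f" for S :: "real set" and f
    using continuous_on_compose2[OF Wc that] by simp
  have Wi: "(\<lambda>t. W (a,t) - W (b,t)) integrable_on {c..d}" "(\<lambda>t. W (t,a) - W (t,b)) integrable_on {c..d}"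
    "(\<lambda>t. W (a,t)) integrable_on {c..d}" "(\<lambda>t. W (t,a)) integrable_on {c..d}" for a b c d
    by (auto intro!: integrable_continuous_real continuous_intros cont)
  define F where "F x y r = p * integral {y..y+r} (\<lambda>t. W (x+r,t) - W (x,t))
     + q * integral {x..x+r} (\<lambda>s. W (s,y+r) - W (s,y)) - integral (cbox (x,y) (x+r,y+r)) G" for x y r
  have "F x y r = 0"
  proof (rule squares_additive_eq_0[OF _ _ r])
    fix x y r :: real assume r: "r > 0"
    have c1: "integral {b..b+r} (\<lambda>t. W (a,t)) = integral {b..b+r/2} (\<lambda>t. W (a,t))
       + integral {b+r/2..b+r} (\<lambda>t. W (a,t))" for a b
      using r Wi by (intro Henstock_Kurzweil_Integration.integral_combine[symmetric]) auto
    have c2: "integral {b..b+r} (\<lambda>t. W (t,a)) = integral {b..b+r/2} (\<lambda>t. W (t,a))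
       + integral {b+r/2..b+r} (\<lambda>t. W (t,a))" for a b
      using r Wi by (intro Henstock_Kurzweil_Integration.integral_combine[symmetric]) auto
    have r2: "a + r/2 + r/2 = a + r" for a by simp
    show "F x y r = F x y (r/2) + F (x+r/2) y (r/2) + F x (y+r/2) (r/2) + F (x+r/2) (y+r/2) (r/2)"
      unfolding F_def r2 integral_diff[OF Wi(3) Wi(3)] integral_diff[OF Wi(4) Wi(4)] c1 c2
        integral_split_square[OF G r]
      by (simp add: algebra_simps)
  next
    fix z :: "real \<times> real" and e :: real assume e: "e > 0"
    \<comment> \<open>\<open>M\<close> counts errors in units of
      \<open>\<epsilon> * r\<^sup>2\<close>: four for each pair of opposite edges, weighted by
      \<open>norm p\<close> and \<open>norm q\<close>, and one for the area integral.\<close>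
    define M where "M = 4 * norm p + 4 * norm q + 1"
    define \<epsilon> where "\<epsilon> = e / M"
    have M: "M > 0" by (simp add: M_def add_nonneg_pos)
    have \<epsilon>: "\<epsilon> > 0" using e M by (simp add: \<epsilon>_def)
    interpret L: bounded_linear "L z" using W has_derivative_bounded_linear by blast
    from W[of z, unfolded has_derivative_at_alt] \<epsilon> obtain d1 where d1: "d1 > 0"
      "\<And>w. norm (w - z) < d1 \<Longrightarrow> norm (W w - W z - L z (w - z)) \<le> \<epsilon> * norm (w - z)" by blast
    have "isCont G z" using G by (metis UNIV_I continuous_on_eq_continuous_at open_UNIV)
    with \<epsilon> obtain d2 where d2: "d2 > 0" "\<And>w. norm (w - z) < d2 \<Longrightarrow> norm (G w - G z) < \<epsilon>"
      by (auto simp: continuous_at_eps_delta dist_norm)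
    show "\<exists>d>0. \<forall>x y r. 0 < r \<and> r < d \<and> z \<in> cbox (x,y) (x+r,y+r) \<longrightarrow> norm (F x y r) \<le> e * r\<^sup>2"
    proof (intro exI conjI allI impI; (elim conjE)?)
      show "min d1 d2 / 2 > 0" using d1 d2 by simp
      fix x y r :: real assume r: "0 < r" "r < min d1 d2 / 2" and z: "z \<in> cbox (x,y) (x+r,y+r)"
      have near: "norm (w - z) \<le> 2 * r" if "w \<in> cbox (x,y) (x+r,y+r)" for w
      proof -
        have "norm (w - z) \<le> norm (fst (w-z)) + norm (snd (w-z))"
          by (metis norm_Pair_le prod.collapse)
        also have "\<dots> \<le> r + r"
          using that z by (cases w; cases z) (intro add_mono; auto simp: cbox_Pair_eq)
        finally show ?thesis by simp
      qed
      have R: "norm (W w - W z - L z (w - z)) \<le> \<epsilon> * (2*r)" if "w \<in> cbox (x,y) (x+r,y+r)" for w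
        using d1(2)[of w] near[OF that] r \<epsilon> by (smt (verit) mult_left_mono min_less_iff_conj field_sum_of_halves)
      \<comment> \<open>Two points of the square are compared through \<open>z\<close>, each
        contributing a linearisation error of at most \<open>2 * \<epsilon> * r\<close>.\<close>
      have R2: "norm (W w - W w' - L z (w - w')) \<le> 4 * \<epsilon> * r"
        if "w \<in> cbox (x,y) (x+r,y+r)" "w' \<in> cbox (x,y) (x+r,y+r)" for w w'
      proof -
        have "W w - W w' - L z (w - w') = (W w - W z - L z (w - z)) - (W w' - W z - L z (w' - z))"
          by (simp add: L.diff)
        then have "norm (W w - W w' - L z (w - w'))
            \<le> norm (W w - W z - L z (w - z)) + norm (W w' - W z - L z (w' - z))"
          using norm_triangle_ineq4 by metis
        then show ?thesis using R[OF that(1)] R[OF that(2)] by linarith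
      qed
      have Lr: "L z (r,0) = r *\<^sub>R L z (1,0)" "L z (0,r) = r *\<^sub>R L z (0,1)"
        by (simp_all flip: L.scaleR)
      have "norm (integral {y..y+r} (\<lambda>t. W (x+r,t) - W (x,t)) - (y+r-y) *\<^sub>R L z (r,0)) \<le> 4 * \<epsilon> * r * (y+r-y)"
        using r R2[of "(x+r,t)" "(x,t)" for t]
        by (intro integral_bound_const) (auto intro!: continuous_intros cont simp: cbox_Pair_eq)
      then have b1: "norm (integral {y..y+r} (\<lambda>t. W (x+r,t) - W (x,t)) - r\<^sup>2 *\<^sub>R L z (1,0)) \<le> 4 * \<epsilon> * r\<^sup>2"
        by (simp add: Lr power2_eq_square)
      have "norm (integral {x..x+r} (\<lambda>t. W (t,y+r) - W (t,y)) - (x+r-x) *\<^sub>R L z (0,r)) \<le> 4 * \<epsilon> * r * (x+r-x)"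
        using r R2[of "(t,y+r)" "(t,y)" for t]
        by (intro integral_bound_const) (auto intro!: continuous_intros cont simp: cbox_Pair_eq)
      then have b2: "norm (integral {x..x+r} (\<lambda>t. W (t,y+r) - W (t,y)) - r\<^sup>2 *\<^sub>R L z (0,1)) \<le> 4 * \<epsilon> * r\<^sup>2"
        by (simp add: Lr power2_eq_square)
      have con: "measure lborel (cbox (x,y) (x+r,y+r)) = r\<^sup>2"
        using r by (simp add: content_Pair power2_eq_square)
      have Gi: "(G has_integral integral (cbox (x,y) (x+r,y+r)) G) (cbox (x,y) (x+r,y+r))"
        by (intro integrable_integral integrable_continuous) (rule continuous_on_subset[OF G], simp)
      have "norm (integral (cbox (x,y) (x+r,y+r)) G - measure lborel (cbox (x,y) (x+r,y+r)) *\<^sub>R G z)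
         \<le> \<epsilon> * measure lborel (cbox (x,y) (x+r,y+r))"
      proof (rule has_integral_bound)
        show "((\<lambda>w. G w - G z) has_integral (integral (cbox (x,y) (x+r,y+r)) G
           - measure lborel (cbox (x,y) (x+r,y+r)) *\<^sub>R G z)) (cbox (x,y) (x+r,y+r))"
          by (intro has_integral_diff Gi has_integral_const)
        show "norm (G w - G z) \<le> \<epsilon>" if "w \<in> cbox (x,y) (x+r,y+r)" for w
          using d2(2)[of w] near[OF that] r by simp
      qed (use \<epsilon> in simp)
      then have b3: "norm (integral (cbox (x,y) (x+r,y+r)) G - r\<^sup>2 *\<^sub>R G z) \<le> \<epsilon> * r\<^sup>2"
        unfolding con .
      \<comment> \<open>The three subtracted main terms cancel by \<open>eq\<close> at
        \<open>z\<close>, so only the errors bounded above remain.\<close>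
      have "F x y r = p * (integral {y..y+r} (\<lambda>t. W (x+r,t) - W (x,t)) - r\<^sup>2 *\<^sub>R L z (1,0))
          + q * (integral {x..x+r} (\<lambda>t. W (t,y+r) - W (t,y)) - r\<^sup>2 *\<^sub>R L z (0,1))
          - (integral (cbox (x,y) (x+r,y+r)) G - r\<^sup>2 *\<^sub>R G z)"
        unfolding F_def eq[of z, symmetric] scaleR_conv_of_real by (simp add: algebra_simps)
      also have "norm \<dots> \<le> norm p * (4 * \<epsilon> * r\<^sup>2) + norm q * (4 * \<epsilon> * r\<^sup>2) + \<epsilon> * r\<^sup>2"
        by (intro order.trans[OF norm_triangle_ineq4] order.trans[OF norm_triangle_ineq]
            add_mono b3 order.refl)
          (auto simp: norm_mult intro!: add_mono mult_left_mono b1 b2)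
      also have "\<dots> = \<epsilon> * M * r\<^sup>2" by (simp add: M_def algebra_simps)
      also have "\<dots> = e * r\<^sup>2" using M by (simp add: \<epsilon>_def)
      finally show "norm (F x y r) \<le> e * r\<^sup>2" .
    qed
  qed
  then show ?thesis by (simp add: F_def)
qed

section \<open>Fourier uniqueness on the torus\<close>

definition torus_char :: "int \<Rightarrow> int \<Rightarrow> real \<times> real \<Rightarrow> complex" where
  "torus_char m n x = cis (2 * pi * (of_int m * fst x + of_int n * snd x))"

lemma torus_char_add: "torus_char (m+m') (n+n') x = torus_char m n x * torus_char m' n' x"
  by (simp add: torus_char_def cis_mult algebra_simps)

lemma continuous_on_torus_char [continuous_intros]: "continuous_on S (torus_char m n)"
  unfolding torus_char_def cis_conv_exp by (intro continuous_intros)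

abbreviation unit_square :: "(real \<times> real) set" where
  "unit_square \<equiv> cbox (0,0) (1,1)"

definition fourier_null :: "(real \<times> real \<Rightarrow> complex) \<Rightarrow> bool" where
  "fourier_null X \<longleftrightarrow> continuous_on unit_square X \<and>
     (\<forall>m n. ((\<lambda>x. X x * torus_char m n x) has_integral 0) unit_square)"

lemma fourier_null_cmult: "fourier_null X \<Longrightarrow> fourier_null (\<lambda>x. c * X x)"
  unfolding fourier_null_def
  using has_integral_mult_right[of "\<lambda>x. X x * torus_char m n x" 0 unit_square c for m n]
  by (auto intro!: continuous_intros simp: mult.assoc)

lemma fourier_null_add: "fourier_null X \<Longrightarrow> fourier_null Y \<Longrightarrow> fourier_null (\<lambda>x. X x + Y x)"
  unfolding fourier_null_def
  using has_integral_add[of "\<lambda>x. X x * torus_char m n x" 0 unit_square "\<lambda>x. Y x * torus_char m n x" 0 for m n]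
  by (auto intro!: continuous_intros simp: distrib_right)

text \<open>Multiplication by a character only shifts the index of the Fourier coefficients.\<close>

lemma fourier_null_char: "fourier_null X \<Longrightarrow> fourier_null (\<lambda>x. X x * torus_char m n x)"
  unfolding fourier_null_def
  by (auto intro!: continuous_intros simp: mult.assoc simp flip: torus_char_add)

text \<open>The standard embedding of the torus as a product of two unit circles; its compact image
  is where polynomials are used for approximation.\<close>

definition circles :: "real \<times> real \<Rightarrow> complex \<times> complex" where
  "circles x = (torus_char 1 0 x, torus_char 0 1 x)"

text \<open>Real and imaginary parts of a unit complex number are combinations of it and its
  conjugate, so real linear coordinates on the embedded torus are trigonometric polynomials.\<close>

lemma real_linear_circles:
  fixes f :: "complex \<times> complex \<Rightarrow> real"
  assumes "bounded_linear f"
  obtains a b c d where "\<And>x. complex_of_real (f (circles x)) =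
     a * torus_char 1 0 x + b * torus_char (-1) 0 x + c * torus_char 0 1 x + d * torus_char 0 (-1) x"
proof
  interpret bounded_linear f by fact
  let ?f = "\<lambda>z. complex_of_real (f z)"
  fix x :: "real \<times> real"
  have e: "(z, w) = Re z *\<^sub>R (1,0) + Im z *\<^sub>R (\<i>,0) + Re w *\<^sub>R (0,1) + Im w *\<^sub>R (0,\<i>)" for z w :: complex
    by (simp add: complex_eq_iff)
  have lin: "?f (z, w) = Re z * ?f (1,0) + Im z * ?f (\<i>,0) + Re w * ?f (0,1) + Im w * ?f (0,\<i>)" for z w
    by (subst e) (simp only: add scaleR of_real_add of_real_mult real_scaleR_def)
  have neg: "torus_char (-1) 0 x = cnj (torus_char 1 0 x)" "torus_char 0 (-1) x = cnj (torus_char 0 1 x)"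
    by (simp_all add: torus_char_def cis_cnj)
  have re: "complex_of_real (Re z) = (z + cnj z) / 2" and im: "complex_of_real (Im z) = - \<i> * (z - cnj z) / 2" for z
    by (simp_all add: complex_eq_iff)
  show "?f (circles x) = (?f (1,0) - \<i> * ?f (\<i>,0)) / 2 * torus_char 1 0 x
     + (?f (1,0) + \<i> * ?f (\<i>,0)) / 2 * torus_char (-1) 0 x
     + (?f (0,1) - \<i> * ?f (0,\<i>)) / 2 * torus_char 0 1 x
     + (?f (0,1) + \<i> * ?f (0,\<i>)) / 2 * torus_char 0 (-1) x"
    unfolding circles_def by (subst lin) (simp add: neg re im algebra_simps add_divide_distrib diff_divide_distrib)
qed

text \<open>Quantifying over all null functions makes the claim stable under products of polynomials.\<close>
lemma fourier_null_polynomial: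
  fixes f :: "complex \<times> complex \<Rightarrow> real"
  assumes "real_polynomial_function f" "fourier_null X"
  shows "fourier_null (\<lambda>x. X x * f (circles x))"
  using assms
proof (induction arbitrary: X)
  case (linear f)
  then obtain a b c d where *: "\<And>x. complex_of_real (f (circles x)) =
     a * torus_char 1 0 x + b * torus_char (-1) 0 x + c * torus_char 0 1 x + d * torus_char 0 (-1) x"
    using real_linear_circles by blast
  have "fourier_null (\<lambda>x. a * (X x * torus_char 1 0 x) + b * (X x * torus_char (-1) 0 x)
       + c * (X x * torus_char 0 1 x) + d * (X x * torus_char 0 (-1) x))"
    using linear by (intro fourier_null_add fourier_null_cmult fourier_null_char)
  then show ?case by (simp add: * algebra_simps)
next
  case (const c)
  then show ?case using fourier_null_cmult[of X c] by (simp add: mult.commute)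
next
  case (add f g)
  then show ?case using fourier_null_add[of "\<lambda>x. X x * f (circles x)" "\<lambda>x. X x * g (circles x)"]
    by (simp add: algebra_simps)
next
  case (mult f g)
  from mult.IH(2)[OF mult.IH(1)[OF mult.prems]] show ?case by (simp add: mult.assoc)
qed

text \<open>On the closed unit square \<open>circles\<close> identifies only points of opposite
  edges, and there a periodic function takes equal values.\<close>

lemma circles_eq_imp:
  fixes W :: "real \<times> real \<Rightarrow> 'a"
  assumes per: "\<And>s t. W (s+1,t) = W (s,t)" "\<And>s t. W (s,t+1) = W (s,t)"
    and "x \<in> unit_square" "y \<in> unit_square" "circles x = circles y"
  shows "W x = W y"
proof -
  have one: "a = b \<or> (a = 0 \<and> b = 1) \<or> (a = 1 \<and> b = 0)"
    if "cis (2*pi*a) = cis (2*pi*b)" "0 \<le> a" "a \<le> 1" "0 \<le> b" "b \<le> 1" for a b :: real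
  proof -
    have "cis (2*pi*a - 2*pi*b) = 1" using that(1) by (simp flip: cis_divide)
    then have "cos (2*pi*(a-b)) = 1" by (simp add: complex_eq_iff algebra_simps)
    then obtain k :: int where "2*pi*(a-b) = k * (2*pi)" using cos_one_2pi_int by force
    then have "a - b = k" by simp
    moreover from this have "k = 0 \<or> k = 1 \<or> k = -1" using that(2-) by linarith
    ultimately show ?thesis using that(2-) by auto
  qed
  obtain a b c d where xy: "x = (a,b)" "y = (c,d)" by force
  have "a = c \<or> (a = 0 \<and> c = 1) \<or> (a = 1 \<and> c = 0)" "b = d \<or> (b = 0 \<and> d = 1) \<or> (b = 1 \<and> d = 0)"
    using one[of a c] one[of b d] assms by (auto simp: xy cbox_Pair_eq circles_def torus_char_def)
  moreover have "W (0,t) = W (1,t)" "W (t,0) = W (t,1)" for t using per(1)[of 0 t] per(2)[of t 0] by simp_all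
  ultimately show ?thesis unfolding xy by (elim disjE conjE) (simp_all only:)
qed

text \<open>A periodic function descends to the embedded torus through an arbitrary choice of
  preimages. The descended function is continuous because \<open>circles\<close>, on a compact
  square, is a quotient map onto its image.\<close>

lemma periodic_factor_circles:
  fixes W :: "real \<times> real \<Rightarrow> 'a::topological_space"
  assumes W: "continuous_on unit_square W"
    and per: "\<And>s t. W (s+1,t) = W (s,t)" "\<And>s t. W (s,t+1) = W (s,t)"
  obtains V where "continuous_on (circles ` unit_square) V" "\<And>x. x \<in> unit_square \<Longrightarrow> V (circles x) = W x"
proof -
  define V where "V y = W (SOME x. x \<in> unit_square \<and> circles x = y)" for y
  have V: "V (circles x) = W x" if "x \<in> unit_square" for x
  proof -
    let ?x = "SOME x'. x' \<in> unit_square \<and> circles x' = circles x"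
    have x: "?x \<in> unit_square" "circles ?x = circles x"
      using someI[of "\<lambda>x'. x' \<in> unit_square \<and> circles x' = circles x" x] that by blast+
    show ?thesis unfolding V_def by (rule circles_eq_imp[OF per x(1) that x(2)])
  qed
  have cont: "continuous_on unit_square circles"
    unfolding circles_def by (intro continuous_intros)
  have "continuous_on (circles ` unit_square) V"
    unfolding continuous_on_open
  proof (intro allI impI)
    fix U assume U: "openin (top_of_set (V ` circles ` unit_square)) U"
    have im: "V ` circles ` unit_square = W ` unit_square"
      unfolding image_image by (rule image_cong[OF refl V])
    have "openin (top_of_set unit_square) (unit_square \<inter> W -` U)"
      using W[unfolded continuous_on_open] U[unfolded im] by blast
    also have "unit_square \<inter> W -` U = unit_square \<inter> circles -` (circles ` unit_square \<inter> V -` U)"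
      by (rule set_eqI) (simp add: V cong: conj_cong)
    finally show "openin (top_of_set (circles ` unit_square)) (circles ` unit_square \<inter> V -` U)"
      using Abstract_Topology_2.continuous_imp_quotient_map[OF cont refl compact_cbox, of "circles ` unit_square \<inter> V -` U"]
      by blast
  qed
  then show thesis using V by (rule that)
qed

text \<open>By Stone-Weierstrass the conjugate of \<open>W\<close> is uniformly close to a
  polynomial in \<open>circles\<close>, and \<open>W\<close> is orthogonal to such polynomials.
  Hence the integral of \<open>W * cnj W\<close> is arbitrarily small, so it is zero, and continuity
  gives \<open>W = 0\<close> on the square.\<close>

lemma fourier_null_eq_0:
  assumes null: "fourier_null W"
    and per: "\<And>s t. W (s+1,t) = W (s,t)" "\<And>s t. W (s,t+1) = W (s,t)"
    and x: "x \<in> unit_square"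
  shows "W x = 0"
proof -
  have W: "continuous_on unit_square W" using null by (simp add: fourier_null_def)
  obtain V where V: "continuous_on (circles ` unit_square) V"
    "\<And>x. x \<in> unit_square \<Longrightarrow> V (circles x) = W x"
    using periodic_factor_circles[of W] W per by blast
  have circ: "continuous_on S circles" for S
    unfolding circles_def by (intro continuous_intros)
  have comp: "compact (circles ` unit_square)"
    by (intro compact_continuous_image circ compact_cbox)
  obtain B where B: "B > 0" "\<And>x. x \<in> unit_square \<Longrightarrow> norm (W x) \<le> B"
    using compact_imp_bounded[OF compact_continuous_image[OF W compact_cbox]]
    by (auto simp: bounded_pos)
  define I where "I = integral unit_square (\<lambda>x. W x * cnj (W x))"
  have WI: "((\<lambda>x. W x * cnj (W x)) has_integral I) unit_square"
    unfolding I_def by (intro integrable_integral integrable_continuous continuous_intros W)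
  have "norm I \<le> e" if e: "e > 0" for e
  proof -
    have cV: "continuous_on (circles ` unit_square) (\<lambda>y. cnj (V y))"
      by (intro continuous_intros V)
    \<comment> \<open>The tolerance \<open>e/B\<close> becomes \<open>e\<close> after multiplication
      by \<open>W\<close>, which is bounded by \<open>B\<close>.\<close>
    obtain g where g: "polynomial_function g" "\<And>y. y \<in> circles ` unit_square \<Longrightarrow> norm (cnj (V y) - g y) < e/B"
      using Stone_Weierstrass_polynomial_function[OF comp cV, of "e/B"] e B(1) by (metis divide_pos_pos)
    have rp: "real_polynomial_function (\<lambda>y. Re (g y))" "real_polynomial_function (\<lambda>y. Im (g y))"
      using g(1) polynomial_function_iff_Basis_inner[of g] by (auto simp: Basis_complex_def)
    have "fourier_null (\<lambda>x. W x * Re (g (circles x)) + \<i> * (W x * Im (g (circles x))))"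
      using fourier_null_polynomial[OF rp(1) null] fourier_null_polynomial[OF rp(2) null]
      by (intro fourier_null_add fourier_null_cmult)
    also have "(\<lambda>x. W x * Re (g (circles x)) + \<i> * (W x * Im (g (circles x)))) = (\<lambda>x. W x * g (circles x))"
      by (simp add: fun_eq_iff complex_eq_iff)
    \<comment> \<open>The coefficient of frequency zero is the plain integral.\<close>
    finally have "((\<lambda>x. W x * g (circles x) * torus_char 0 0 x) has_integral 0) unit_square"
      unfolding fourier_null_def by blast
    then have "((\<lambda>x. W x * g (circles x)) has_integral 0) unit_square"
      by (simp add: torus_char_def)
    from has_integral_diff[OF WI this]
    have "((\<lambda>x. W x * (cnj (W x) - g (circles x))) has_integral I) unit_square"
      by (simp add: algebra_simps)
    then have "norm I \<le> e * measure lborel unit_square"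
    proof (rule has_integral_bound[rotated])
      fix x assume x: "x \<in> unit_square"
      have "norm (W x) * norm (cnj (W x) - g (circles x)) \<le> B * (e/B)"
        using B x g(2)[of "circles x"] V(2)[OF x] by (intro mult_mono) auto
      then show "norm (W x * (cnj (W x) - g (circles x))) \<le> e" using B by (simp add: norm_mult)
    qed (use e in simp)
    then show ?thesis by (simp add: content_Pair)
  qed
  then have "I = 0" by (metis dense not_le zero_less_norm_iff)
  have "((\<lambda>x. Re (W x * cnj (W x))) has_integral 0) unit_square"
    using has_integral_linear[OF WI bounded_linear_Re] \<open>I = 0\<close> by (simp add: o_def)
  then have "Re (W x * cnj (W x)) = 0"
    by (rule has_integral_0_cbox_imp_0[rotated 2])
       (use x in \<open>auto intro!: continuous_intros W simp: box_ne_empty Basis_prod_def\<close>)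
  then show ?thesis by (simp flip: power2_eq_square add: sum_power2_eq_zero_iff complex_eq_iff)
qed

section \<open>Lattices and multipliers\<close>

text \<open>One family with growth \<open>A\<close> and frequency \<open>E\<close> covers everything
  exponential here: characters are \<open>A = 0\<close>, multipliers are \<open>E = -B\<close>, and
  the explicit sections are built from it.\<close>

definition wave :: "complex \<Rightarrow> complex \<Rightarrow> complex \<Rightarrow> complex" where
  "wave A E z = exp (complex_of_real (2 * pi * (A \<bullet> z)) + \<i> * complex_of_real (2 * pi * (E \<bullet> z)))"

lemma wave_nz [simp]: "wave A E z \<noteq> 0"
  by (simp add: wave_def)

lemma wave_mult: "wave A E z * wave A' E' z = wave (A+A') (E+E') z"
  by (simp add: wave_def algebra_simps inner_add_left flip: exp_add)

lemma wave_add: "wave A E (z+w) = wave A E z * wave A E w"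
  by (simp add: wave_def algebra_simps inner_add_right flip: exp_add)

lemma wave_0 [simp]: "wave 0 0 z = 1" "wave A E 0 = 1"
  by (simp_all add: wave_def)

lemma wave_has_derivative:
  "(wave A E has_derivative (\<lambda>w. wave A E z * (2 * pi * (A \<bullet> w) + \<i> * (2 * pi * (E \<bullet> w))))) (at z)"
proof -
  have "((\<lambda>z. complex_of_real (2 * pi * (A \<bullet> z)) + \<i> * complex_of_real (2 * pi * (E \<bullet> z)))
     has_derivative (\<lambda>w. complex_of_real (2 * pi * (A \<bullet> w)) + \<i> * complex_of_real (2 * pi * (E \<bullet> w)))) (at z)"
    by (intro derivative_intros has_derivative_mult_right has_derivative_of_real
         has_derivative_inner_right has_derivative_ident)
  from has_derivative_compose[OF this DERIV_exp[unfolded has_field_derivative_def]] show ?thesis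
    unfolding wave_def by (rule has_derivative_eq_rhs) (auto simp: fun_eq_iff algebra_simps)
qed

lemma continuous_on_wave [continuous_intros]: "continuous_on S (wave A E)"
  unfolding wave_def by (intro continuous_intros)

lemma hAB_eq_wave: "hAB A B = wave A (-B)"
  by (simp add: fun_eq_iff hAB_def wave_def)

lemma wave_eq_1:
  assumes "E \<bullet> \<gamma> \<in> \<int>" shows "wave 0 E \<gamma> = 1"
  using assms by (auto simp: wave_def exp_eq_1 elim!: Ints_cases)

lemma wave_eq_1_iff: "wave A E \<gamma> = 1 \<longleftrightarrow> A \<bullet> \<gamma> = 0 \<and> E \<bullet> \<gamma> \<in> \<int>"
proof
  assume "wave A E \<gamma> = 1"
  then obtain n :: int where "2 * pi * (A \<bullet> \<gamma>) = 0" "2 * pi * (E \<bullet> \<gamma>) = 2 * n * pi"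
    unfolding wave_def exp_eq_1 by auto
  then have "A \<bullet> \<gamma> = 0" "E \<bullet> \<gamma> = n" by simp_all
  then show "A \<bullet> \<gamma> = 0 \<and> E \<bullet> \<gamma> \<in> \<int>" by simp
next
  assume "A \<bullet> \<gamma> = 0 \<and> E \<bullet> \<gamma> \<in> \<int>"
  then show "wave A E \<gamma> = 1"
    using wave_eq_1[of E \<gamma>] by (simp add: wave_def)
qed

locale complex_lattice =
  fixes \<omega>1 \<omega>2 :: complex and \<Gamma> :: "complex set"
  assumes indep: "Im (cnj \<omega>1 * \<omega>2) \<noteq> 0"
    and lat: "\<Gamma> = {of_int m * \<omega>1 + of_int n * \<omega>2 | m n. True}"
begin

lemma generators: "\<omega>1 \<in> \<Gamma>" "\<omega>2 \<in> \<Gamma>"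
proof -
  have "\<omega>1 = of_int 1 * \<omega>1 + of_int 0 * \<omega>2" "\<omega>2 = of_int 0 * \<omega>1 + of_int 1 * \<omega>2" by simp_all
  then show "\<omega>1 \<in> \<Gamma>" "\<omega>2 \<in> \<Gamma>" unfolding lat by blast+
qed

lemma det_nz: "Re \<omega>1 * Im \<omega>2 - Im \<omega>1 * Re \<omega>2 \<noteq> 0"
  using indep by simp

text \<open>Cramer's rule. It produces both the pair \<open>(A, B)\<close> of a given multiplier and
  the dual lattice vector of a given integer frequency.\<close>

lemma inner_solve: "\<exists>A. A \<bullet> \<omega>1 = x \<and> A \<bullet> \<omega>2 = y"
proof -
  let ?d = "Re \<omega>1 * Im \<omega>2 - Im \<omega>1 * Re \<omega>2"
  let ?A = "Complex ((x * Im \<omega>2 - y * Im \<omega>1) / ?d) ((y * Re \<omega>1 - x * Re \<omega>2) / ?d)"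
  have "?A \<bullet> \<omega>1 = (x * ?d) / ?d" "?A \<bullet> \<omega>2 = (y * ?d) / ?d"
    by (simp_all add: inner_complex_def algebra_simps flip: add_divide_distrib diff_divide_distrib)
  then show ?thesis using det_nz by (intro exI[of _ ?A]) simp
qed

lemma coordinates:
  obtains x y :: real where "z = x *\<^sub>R \<omega>1 + y *\<^sub>R \<omega>2"
proof
  let ?d = "Re \<omega>1 * Im \<omega>2 - Im \<omega>1 * Re \<omega>2"
  let ?x = "Re z * Im \<omega>2 - Im z * Re \<omega>2" and ?y = "Re \<omega>1 * Im z - Im \<omega>1 * Re z"
  have "?d *\<^sub>R z = ?x *\<^sub>R \<omega>1 + ?y *\<^sub>R \<omega>2" by (simp add: complex_eq_iff algebra_simps)
  then have "inverse ?d *\<^sub>R (?d *\<^sub>R z) = inverse ?d *\<^sub>R (?x *\<^sub>R \<omega>1 + ?y *\<^sub>R \<omega>2)" by simp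
  then show "z = (inverse ?d * ?x) *\<^sub>R \<omega>1 + (inverse ?d * ?y) *\<^sub>R \<omega>2"
    using det_nz by (simp add: scaleR_add_right)
qed

lemma inner_eq_0_imp: assumes "A \<bullet> \<omega>1 = 0" "A \<bullet> \<omega>2 = 0" shows "A = 0"
proof -
  obtain x y where "A = x *\<^sub>R \<omega>1 + y *\<^sub>R \<omega>2" by (rule coordinates)
  then have "A \<bullet> A = x * (A \<bullet> \<omega>1) + y * (A \<bullet> \<omega>2)" by (metis inner_add_right inner_scaleR_right)
  with assms show ?thesis by simp
qed

lemma inner_lattice: "E \<bullet> (of_int m * \<omega>1 + of_int n * \<omega>2) = of_int m * (E \<bullet> \<omega>1) + of_int n * (E \<bullet> \<omega>2)"
  by (simp add: inner_complex_def algebra_simps)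

lemma dual_iff: "E \<in> dual_lattice \<Gamma> \<longleftrightarrow> E \<bullet> \<omega>1 \<in> \<int> \<and> E \<bullet> \<omega>2 \<in> \<int>"
proof
  assume "E \<bullet> \<omega>1 \<in> \<int> \<and> E \<bullet> \<omega>2 \<in> \<int>"
  then show "E \<in> dual_lattice \<Gamma>"
    by (auto simp: dual_lattice_def lat inner_lattice)
qed (use generators in \<open>auto simp: dual_lattice_def\<close>)

text \<open>The value 1 at 0 and the negative multiples come from cancelling the nonzero number
  \<open>h \<omega>\<close>.\<close>

lemma hom_of_int_mult:
  assumes h: "lattice_hom \<Gamma> h" and \<omega>: "\<omega> \<in> {\<omega>1, \<omega>2}"
  shows "h (of_int m * \<omega>) = h \<omega> powi m"
proof -
  have mem: "of_int k * \<omega> \<in> \<Gamma>" for k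
  proof -
    have "of_int k * \<omega>1 = of_int k * \<omega>1 + of_int 0 * \<omega>2" "of_int k * \<omega>2 = of_int 0 * \<omega>1 + of_int k * \<omega>2"
      by simp_all
    then show ?thesis using \<omega> unfolding lat by blast
  qed
  have nz: "h \<omega> \<noteq> 0" using h mem[of 1] by (simp add: lattice_hom_def)
  have step: "h (of_int (k+1) * \<omega>) = h (of_int k * \<omega>) * h \<omega>" for k
    using h mem[of k] mem[of 1] by (simp add: lattice_hom_def distrib_right)
  have h0: "h 0 = 1"
    using step[of 0] nz by simp
  show ?thesis
  proof (induction m rule: int_induct[where k=0])
    case base then show ?case by (simp add: h0)
  next
    case (step1 i) then show ?case using nz by (subst step) (simp add: power_int_add_1)
  next
    case (step2 i)
    have "h (of_int (i-1) * \<omega>) * h \<omega> = h \<omega> powi (i-1) * h \<omega>"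
      using step[of "i-1"] step2 nz by (simp add: power_int_add_1[symmetric])
    then show ?case using nz by simp
  qed
qed

lemma hom_eqI:
  assumes "lattice_hom \<Gamma> h" "lattice_hom \<Gamma> h'" "h \<omega>1 = h' \<omega>1" "h \<omega>2 = h' \<omega>2" "\<gamma> \<in> \<Gamma>"
  shows "h \<gamma> = h' \<gamma>"
proof -
  have mem: "of_int m * \<omega>1 \<in> \<Gamma>" "of_int m * \<omega>2 \<in> \<Gamma>" for m
  proof -
    have "of_int m * \<omega>1 = of_int m * \<omega>1 + of_int 0 * \<omega>2" "of_int m * \<omega>2 = of_int 0 * \<omega>1 + of_int m * \<omega>2"
      by simp_all
    then show "of_int m * \<omega>1 \<in> \<Gamma>" "of_int m * \<omega>2 \<in> \<Gamma>" unfolding lat by blast+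
  qed
  obtain m n where \<gamma>: "\<gamma> = of_int m * \<omega>1 + of_int n * \<omega>2" using \<open>\<gamma> \<in> \<Gamma>\<close> lat by blast
  have "k \<gamma> = k \<omega>1 powi m * k \<omega>2 powi n" if "lattice_hom \<Gamma> k" for k
    using that mem hom_of_int_mult[OF that] by (simp add: \<gamma> lattice_hom_def)
  from this[OF assms(1)] this[OF assms(2)] assms(3,4) show ?thesis by simp
qed

lemma lattice_hom_hAB: "lattice_hom \<Gamma> (hAB A B)"
  by (simp add: lattice_hom_def hAB_eq_wave wave_add)

text \<open>The quotient of the two multipliers is the wave of growth \<open>A - A'\<close> and
  frequency \<open>B' - B\<close>. It is 1 on \<Gamma> iff the growth is orthogonal to the
  generators, hence zero, and the frequency is dual.\<close>

lemma hAB_eq_iff: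
  "(\<forall>\<gamma>\<in>\<Gamma>. hAB A' B' \<gamma> = hAB A B \<gamma>) \<longleftrightarrow> A' = A \<and> B' - B \<in> dual_lattice \<Gamma>"
proof -
  have "hAB A' B' \<gamma> = hAB A B \<gamma> \<longleftrightarrow> (A - A') \<bullet> \<gamma> = 0 \<and> (B' - B) \<bullet> \<gamma> \<in> \<int>" for \<gamma>
  proof -
    have "hAB A B \<gamma> = hAB A' B' \<gamma> * wave (A - A') (B' - B) \<gamma>"
      by (simp add: hAB_eq_wave wave_mult)
    moreover have "hAB A' B' \<gamma> \<noteq> 0" by (simp add: hAB_eq_wave)
    ultimately have "hAB A' B' \<gamma> = hAB A B \<gamma> \<longleftrightarrow> wave (A - A') (B' - B) \<gamma> = 1" by auto
    then show ?thesis by (simp add: wave_eq_1_iff)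
  qed
  then show ?thesis
    using inner_eq_0_imp[of "A - A'"] generators by (auto simp: dual_lattice_def)
qed

text \<open>Logarithms of \<open>h\<close> at the two generators prescribe the inner products of
  \<open>A\<close> and \<open>B\<close> with them; agreement on generators then extends to
  \<Gamma>.\<close>

lemma hom_eq_hAB:
  assumes h: "lattice_hom \<Gamma> h"
  obtains A B where "\<And>\<gamma>. \<gamma> \<in> \<Gamma> \<Longrightarrow> h \<gamma> = hAB A B \<gamma>"
proof -
  obtain l1 l2 where l: "h \<omega>1 = exp l1" "h \<omega>2 = exp l2"
    using h generators by (metis lattice_hom_def exp_Ln)
  obtain A where A: "A \<bullet> \<omega>1 = Re l1 / (2*pi)" "A \<bullet> \<omega>2 = Re l2 / (2*pi)" using inner_solve by blast
  \<comment> \<open>The minus sign matches the one in front of \<open>B\<close> in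
    \<open>hAB\<close>.\<close>
  obtain B where B: "B \<bullet> \<omega>1 = - Im l1 / (2*pi)" "B \<bullet> \<omega>2 = - Im l2 / (2*pi)" using inner_solve by blast
  have "h \<omega>1 = hAB A B \<omega>1" "h \<omega>2 = hAB A B \<omega>2"
    by (simp_all add: l hAB_def A B flip: complex_eq)
  then show thesis using that hom_eqI[OF h lattice_hom_hAB] by blast
qed

section \<open>Integration and Fourier uniqueness in lattice coordinates\<close>

definition emb :: "real \<times> real \<Rightarrow> complex" where
  "emb x = fst x *\<^sub>R \<omega>1 + snd x *\<^sub>R \<omega>2"

lemma emb_linear: "bounded_linear emb"
  unfolding emb_def by (intro bounded_linear_intros)

lemma continuous_on_emb: "continuous_on S emb"
  unfolding emb_def by (intro continuous_intros)

text \<open>Integration by parts on the torus: in lattice coordinates the boundary terms on opposite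
  edges cancel. The values \<open>\<kappa> = \<i>\<close> and \<open>\<kappa> = -\<i>\<close> give
  twice the antiholomorphic and twice the holomorphic derivative.\<close>

lemma periodic_mean_0:
  fixes \<kappa> :: complex
  assumes P: "\<And>z. (P has_derivative D z) (at z)"
    and eq: "\<And>z. D z 1 + \<kappa> * D z \<i> = G z"
    and G: "continuous_on UNIV G"
    and per: "\<And>z \<gamma>. \<gamma> \<in> \<Gamma> \<Longrightarrow> P (z + \<gamma>) = P z"
  shows "((\<lambda>x. G (emb x)) has_integral 0) unit_square"
proof -
  obtain x1 y1 x2 y2 :: real where co: "1 = x1 *\<^sub>R \<omega>1 + y1 *\<^sub>R \<omega>2" "\<i> = x2 *\<^sub>R \<omega>1 + y2 *\<^sub>R \<omega>2"
    by (meson coordinates)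
  have per': "P (emb (s+1,t)) = P (emb (s,t))" "P (emb (s,t+1)) = P (emb (s,t))" for s t
    using per[OF generators(1), of "emb (s,t)"] per[OF generators(2), of "emb (s,t)"]
    by (simp_all add: emb_def algebra_simps)
  have Gc: "continuous_on UNIV (\<lambda>x. G (emb x))"
    using continuous_on_compose2[OF G continuous_on_emb] by auto
  \<comment> \<open>The factors are the coefficients of the operator after the directions
    \<open>1\<close> and \<open>\<i>\<close> are expanded in the basis \<open>\<omega>1\<close>,
    \<open>\<omega>2\<close>. Writing \<open>0+1\<close> fits the square of side
    \<open>r = 1\<close>.\<close>
  have "integral (cbox (0,0) (0+1,0+1)) (\<lambda>x. G (emb x)) =
     (x1 + \<kappa> * x2) * integral {0..0+1} (\<lambda>t. P (emb (0+1,t)) - P (emb (0,t)))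
     + (y1 + \<kappa> * y2) * integral {0..0+1} (\<lambda>s. P (emb (s,0+1)) - P (emb (s,0)))"
  proof (rule divergence_square)
    show "((\<lambda>x. P (emb x)) has_derivative (\<lambda>v. D (emb x) (emb v))) (at x)" for x
      using has_derivative_compose[OF bounded_linear_imp_has_derivative[OF emb_linear, of "at x"] P] .
    show "(x1 + \<kappa> * x2) * D (emb x) (emb (1,0)) + (y1 + \<kappa> * y2) * D (emb x) (emb (0,1)) = G (emb x)" for x
    proof -
      interpret bounded_linear "D (emb x)" using P has_derivative_bounded_linear by blast
      have "D (emb x) 1 = x1 * D (emb x) \<omega>1 + y1 * D (emb x) \<omega>2"
        "D (emb x) \<i> = x2 * D (emb x) \<omega>1 + y2 * D (emb x) \<omega>2"
        by (subst co; simp add: add scaleR scaleR_conv_of_real[where 'a=complex and x="D (emb x) _"])+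
      then show ?thesis unfolding eq[symmetric] by (simp add: emb_def algebra_simps)
    qed
  qed (use Gc in auto)
  then have "integral unit_square (\<lambda>x. G (emb x)) = 0"
    unfolding per' by simp
  moreover have "(\<lambda>x. G (emb x)) integrable_on unit_square"
    by (rule integrable_continuous) (rule continuous_on_subset[OF Gc], simp)
  ultimately show ?thesis by (metis integrable_integral)
qed

text \<open>Dual lattice vectors correspond to integer pairs \<open>(m, n)\<close>, their inner
  products with the generators, so these coefficients are the Fourier coefficients on the unit
  square.\<close>

lemma periodic_eq_0:
  assumes P: "continuous_on UNIV P"
    and per: "\<And>z \<gamma>. \<gamma> \<in> \<Gamma> \<Longrightarrow> P (z + \<gamma>) = P z"
    and coeff: "\<And>d. d \<in> dual_lattice \<Gamma> \<Longrightarrow> ((\<lambda>x. P (emb x) * wave 0 d (emb x)) has_integral 0) unit_square"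
  shows "P z = 0"
proof -
  have null: "fourier_null (\<lambda>x. P (emb x))"
    unfolding fourier_null_def
  proof (intro conjI allI)
    show "continuous_on unit_square (\<lambda>x. P (emb x))"
      using continuous_on_compose2[OF P continuous_on_emb] by auto
    fix m n :: int
    obtain d where d: "d \<bullet> \<omega>1 = m" "d \<bullet> \<omega>2 = n" using inner_solve by blast
    then have dual: "d \<in> dual_lattice \<Gamma>" by (simp add: dual_iff)
    have "wave 0 d (emb x) = torus_char m n x" for x
      by (simp add: wave_def torus_char_def emb_def inner_add_right d cis_conv_exp mult.commute)
    with coeff[OF dual] show "((\<lambda>x. P (emb x) * torus_char m n x) has_integral 0) unit_square"
      by simp
  qed
  have per': "P (emb (s+1,t)) = P (emb (s,t))" "P (emb (s,t+1)) = P (emb (s,t))" for s t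
    using per[OF generators(1), of "emb (s,t)"] per[OF generators(2), of "emb (s,t)"]
    by (simp_all add: emb_def algebra_simps)
  obtain x y where z: "z = x *\<^sub>R \<omega>1 + y *\<^sub>R \<omega>2" by (rule coordinates)
  \<comment> \<open>Fractional parts move \<open>z\<close> into the fundamental parallelogram by a
    lattice vector.\<close>
  let ?p = "(frac x, frac y)" and ?g = "of_int \<lfloor>x\<rfloor> * \<omega>1 + of_int \<lfloor>y\<rfloor> * \<omega>2"
  have "?g \<in> \<Gamma>" unfolding lat by blast
  moreover have "z = emb ?p + ?g" by (simp add: z emb_def frac_def scaleR_conv_of_real algebra_simps)
  moreover have "?p \<in> unit_square" by (simp add: cbox_Pair_eq frac_ge_0 less_imp_le[OF frac_lt_1])
  then have "P (emb ?p) = 0" using fourier_null_eq_0[OF null per'] by blast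
  ultimately show ?thesis using per by simp
qed

end

section \<open>Reduction of holomorphic sections to a constant coefficient system\<close>

abbreviation cos_half :: "complex \<Rightarrow> complex \<Rightarrow> complex" where
  "cos_half \<beta>0 z \<equiv> complex_of_real (cos (pi * (\<beta>0 \<bullet> z)))"

abbreviation sin_half :: "complex \<Rightarrow> complex \<Rightarrow> complex" where
  "sin_half \<beta>0 z \<equiv> complex_of_real (sin (pi * (\<beta>0 \<bullet> z)))"

text \<open>A Dirac system with constant potential: the left sides are twice the antiholomorphic
  derivative of \<open>u\<close> and twice the holomorphic derivative of \<open>v\<close>.\<close>

definition dirac_pair :: "complex \<Rightarrow> (complex \<Rightarrow> complex) \<Rightarrow> (complex \<Rightarrow> complex) \<Rightarrow> bool" where
  "dirac_pair \<beta>0 u v \<longleftrightarrow> (\<exists>Du Dv. \<forall>z.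
      (u has_derivative Du z) (at z) \<and> (v has_derivative Dv z) (at z) \<and>
      Du z 1 + \<i> * Du z \<i> = of_real pi * \<beta>0 * v z \<and> Dv z 1 - \<i> * Dv z \<i> = - (of_real pi * cnj \<beta>0 * u z))"

text \<open>The components of \<open>e\<^sup>-\<^sup>j\<^sup>\<beta>\<^sup>/\<^sup>2 \<alpha> = u + j v\<close>. Since \<open>b j = j cnj b\<close>, the pair
  \<open>(a, b)\<close> encodes \<open>a + j cnj b\<close>.\<close>
definition rotate_re :: "complex \<Rightarrow> (complex \<Rightarrow> quat) \<Rightarrow> complex \<Rightarrow> complex" where
  "rotate_re \<beta>0 \<alpha> z = cos_half \<beta>0 z * fst (\<alpha> z) + sin_half \<beta>0 z * cnj (snd (\<alpha> z))"

definition rotate_j :: "complex \<Rightarrow> (complex \<Rightarrow> quat) \<Rightarrow> complex \<Rightarrow> complex" where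
  "rotate_j \<beta>0 \<alpha> z = cos_half \<beta>0 z * cnj (snd (\<alpha> z)) - sin_half \<beta>0 z * fst (\<alpha> z)"

text \<open>The product of \<open>e\<^sup>j\<^sup>\<beta>\<^sup>/\<^sup>2\<close> with
  \<open>u + j v\<close>, written in the pair encoding; it inverts the passage to the rotated
  components.\<close>

definition unrotate :: "complex \<Rightarrow> (complex \<Rightarrow> complex) \<Rightarrow> (complex \<Rightarrow> complex) \<Rightarrow> complex \<Rightarrow> quat" where
  "unrotate \<beta>0 u v z = (cos_half \<beta>0 z * u z - sin_half \<beta>0 z * v z,
     cnj (sin_half \<beta>0 z * u z + cos_half \<beta>0 z * v z))"

lemma rotate_eq_0_imp:
  assumes "rotate_re \<beta>0 \<alpha> z = 0" "rotate_j \<beta>0 \<alpha> z = 0"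
  shows "\<alpha> z = 0"
proof -
  obtain a b where ab: "\<alpha> z = (a, b)" by force
  define c s where "c = cos_half \<beta>0 z" "s = sin_half \<beta>0 z"
  have cs: "c * c + s * s = 1"
    unfolding c_s_def by (metis of_real_1 of_real_add of_real_mult power2_eq_square sin_cos_squared_add2)
  have 1: "c * a + s * cnj b = 0" "c * cnj b - s * a = 0"
    using assms by (simp_all add: rotate_re_def rotate_j_def ab c_s_def)
  have "(c * c + s * s) * a = c * (c * a + s * cnj b) - s * (c * cnj b - s * a)"
    "(c * c + s * s) * cnj b = s * (c * a + s * cnj b) + c * (c * cnj b - s * a)"
    by (simp_all add: algebra_simps)
  then show ?thesis unfolding 1 cs ab by (simp add: zero_prod_def)
qed

text \<open>Sections are rotated by half the angle that occurs in the normal; these identities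
  absorb the full angle into the half angle.\<close>

lemma double_angle_combinations:
  fixes t :: real
  shows "complex_of_real (cos t) * cos (2*t) + complex_of_real (sin t) * sin (2*t) = cos t"
    "complex_of_real (cos t) * sin (2*t) - complex_of_real (sin t) * cos (2*t) = sin t"
  using cos_diff[of "2*t" t] sin_diff[of "2*t" t]
  by (simp_all add: mult.commute flip: of_real_mult of_real_add of_real_diff)

lemma normalN_mult:
  "qmul (normalN \<beta>0 z) (x, y) =
     (\<i> * (complex_of_real (cos (2 * (pi * (\<beta>0 \<bullet> z)))) * x + complex_of_real (sin (2 * (pi * (\<beta>0 \<bullet> z)))) * cnj y),
      \<i> * (complex_of_real (cos (2 * (pi * (\<beta>0 \<bullet> z)))) * y - complex_of_real (sin (2 * (pi * (\<beta>0 \<bullet> z)))) * cnj x))"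
  by (simp add: qmul_def normalN_def qexpj_def qi_def beta_fun_def algebra_simps)

lemma has_derivative_angle:
  "((\<lambda>z. cos_half \<beta>0 z) has_derivative
     (\<lambda>w. - sin_half \<beta>0 z * (pi * (\<beta>0 \<bullet> w)))) (at z)"
  "((\<lambda>z. sin_half \<beta>0 z) has_derivative
     (\<lambda>w. cos_half \<beta>0 z * (pi * (\<beta>0 \<bullet> w)))) (at z)"
proof -
  have lin: "((\<lambda>z. pi * (\<beta>0 \<bullet> z)) has_derivative (\<lambda>w. pi * (\<beta>0 \<bullet> w))) (at z)"
    by (intro has_derivative_mult_right has_derivative_inner_right has_derivative_ident)
  show "((\<lambda>z. cos_half \<beta>0 z) has_derivative
     (\<lambda>w. - sin_half \<beta>0 z * (pi * (\<beta>0 \<bullet> w)))) (at z)"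
    by (rule has_derivative_eq_rhs[OF has_derivative_of_real[OF has_derivative_cos[OF lin]]])
       (simp add: fun_eq_iff)
  show "((\<lambda>z. sin_half \<beta>0 z) has_derivative
     (\<lambda>w. cos_half \<beta>0 z * (pi * (\<beta>0 \<bullet> w)))) (at z)"
    by (rule has_derivative_eq_rhs[OF has_derivative_of_real[OF has_derivative_sin[OF lin]]])
       (simp add: fun_eq_iff)
qed

text \<open>Conjugation by \<open>e\<^sup>j\<^sup>\<beta>\<^sup>/\<^sup>2\<close> turns the normal
  into the constant \<open>i\<close>, so the rotated differential of \<alpha> has a complex linear
  and an antilinear component. Differentiating the rotation itself adds the potential terms.\<close>

lemma dirac_pair_rotate:
  assumes "holomorphic_q \<beta>0 \<alpha>"
  shows "dirac_pair \<beta>0 (rotate_re \<beta>0 \<alpha>) (rotate_j \<beta>0 \<alpha>)"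
proof -
  obtain D where D: "\<And>z. (\<alpha> has_derivative D z) (at z)"
    and N: "\<And>z v. D z (\<i> * v) = qmul (normalN \<beta>0 z) (D z v)"
    using assms unfolding holomorphic_q_def by blast
  define c s where "c z = cos_half \<beta>0 z" "s z = sin_half \<beta>0 z" for z
  define Da Db where "Da z w = fst (D z w)" "Db z w = cnj (snd (D z w))" for z w
  let ?u = "rotate_re \<beta>0 \<alpha>" and ?v = "rotate_j \<beta>0 \<alpha>"
  have a: "((\<lambda>z. fst (\<alpha> z)) has_derivative Da z) (at z)" for z
    unfolding Da_Db_def by (intro derivative_intros D)
  have b: "((\<lambda>z. cnj (snd (\<alpha> z))) has_derivative Db z) (at z)" for z
    unfolding Da_Db_def by (intro has_derivative_cnj has_derivative_snd D)
  define Du where "Du z w = c z * Da z w + s z * Db z w + (pi * (\<beta>0 \<bullet> w)) * ?v z" for z w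
  define Dv where "Dv z w = c z * Db z w - s z * Da z w - (pi * (\<beta>0 \<bullet> w)) * ?u z" for z w
  have "(?u has_derivative Du z) (at z)" for z
    unfolding rotate_re_def
    by (rule has_derivative_eq_rhs[OF has_derivative_add[OF has_derivative_mult[OF has_derivative_angle(1) a]
          has_derivative_mult[OF has_derivative_angle(2) b]]])
       (simp add: fun_eq_iff Du_def rotate_j_def c_s_def algebra_simps)
  moreover have "(?v has_derivative Dv z) (at z)" for z
    unfolding rotate_j_def
    by (rule has_derivative_eq_rhs[OF has_derivative_diff[OF has_derivative_mult[OF has_derivative_angle(1) b]
          has_derivative_mult[OF has_derivative_angle(2) a]]])
       (simp add: fun_eq_iff Dv_def rotate_re_def c_s_def algebra_simps)
  moreover have "Du z 1 + \<i> * Du z \<i> = of_real pi * \<beta>0 * ?v z \<and> Dv z 1 - \<i> * Dv z \<i> = - (of_real pi * cnj \<beta>0 * ?u z)" for z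
  proof -
    define C S where "C = complex_of_real (cos (2 * (pi * (\<beta>0 \<bullet> z))))" "S = complex_of_real (sin (2 * (pi * (\<beta>0 \<bullet> z))))"
    have rel: "c z * C + s z * S = c z" "c z * S - s z * C = s z"
      unfolding c_s_def C_S_def by (rule double_angle_combinations)+
    have Di: "Da z \<i> = \<i> * (C * Da z 1 + S * Db z 1)" "Db z \<i> = \<i> * (S * Da z 1 - C * Db z 1)"
      using N[of z 1] normalN_mult[of \<beta>0 z "fst (D z 1)" "snd (D z 1)"]
      by (simp_all add: Da_Db_def C_S_def algebra_simps)
    have \<beta>: "\<beta>0 = (\<beta>0 \<bullet> 1) + \<i> * (\<beta>0 \<bullet> \<i>)" "cnj \<beta>0 = (\<beta>0 \<bullet> 1) - \<i> * (\<beta>0 \<bullet> \<i>)"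
      by (simp_all add: complex_eq_iff inner_complex_def)
    \<comment> \<open>Grouped so that the bracketed coefficients vanish by \<open>rel\<close>,
      leaving the term of order zero.\<close>
    have "Du z 1 + \<i> * Du z \<i> = (c z - (c z * C + s z * S)) * Da z 1 + (s z - (c z * S - s z * C)) * Db z 1
        + pi * (complex_of_real (\<beta>0 \<bullet> 1) + \<i> * (\<beta>0 \<bullet> \<i>)) * ?v z"
      unfolding Du_def Di by (simp add: algebra_simps)
    moreover have "Dv z 1 - \<i> * Dv z \<i> = ((c z * C + s z * S)*(-1) + c z) * Db z 1
        + ((c z * S - s z * C) - s z) * Da z 1
        - pi * (complex_of_real (\<beta>0 \<bullet> 1) - \<i> * (\<beta>0 \<bullet> \<i>)) * ?u z"
      unfolding Dv_def Di by (simp add: algebra_simps)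
    ultimately show ?thesis unfolding rel \<beta>[symmetric] by simp
  qed
  ultimately show ?thesis unfolding dirac_pair_def by blast
qed

text \<open>The converse direction: the Dirac equations say exactly that the two components of the
  rotated differential are complex linear and antilinear.\<close>

lemma holomorphic_unrotate:
  assumes "dirac_pair \<beta>0 u v"
  shows "holomorphic_q \<beta>0 (unrotate \<beta>0 u v)"
proof -
  obtain Du Dv where Du: "\<And>z. (u has_derivative Du z) (at z)" and Dv: "\<And>z. (v has_derivative Dv z) (at z)"
    and eq: "\<And>z. Du z 1 + \<i> * Du z \<i> = of_real pi * \<beta>0 * v z" "\<And>z. Dv z 1 - \<i> * Dv z \<i> = - (of_real pi * cnj \<beta>0 * u z)"
    using assms unfolding dirac_pair_def by blast
  define c s where "c z = cos_half \<beta>0 z" "s z = sin_half \<beta>0 z" for z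
  \<comment> \<open>\<open>h\<close> and \<open>k\<close> are the components of
    \<open>e\<^sup>-\<^sup>j\<^sup>\<beta>\<^sup>/\<^sup>2\<close> times the differential of the
    section: the derivatives of \<open>u\<close> and \<open>v\<close> without the contribution of
    the rotation.\<close>
  define h where "h z w = Du z w - (pi * (\<beta>0 \<bullet> w)) * v z" for z w
  define k where "k z w = Dv z w + (pi * (\<beta>0 \<bullet> w)) * u z" for z w
  define D where "D z w = (c z * h z w - s z * k z w, cnj (s z * h z w + c z * k z w))" for z w
  have "(unrotate \<beta>0 u v has_derivative D z) (at z)" for z
    unfolding unrotate_def
    by (rule has_derivative_eq_rhs[OF has_derivative_Pair[OF
          has_derivative_diff[OF has_derivative_mult[OF has_derivative_angle(1) Du]
            has_derivative_mult[OF has_derivative_angle(2) Dv]]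
          has_derivative_cnj[OF has_derivative_add[OF has_derivative_mult[OF has_derivative_angle(2) Du]
            has_derivative_mult[OF has_derivative_angle(1) Dv]]]]])
       (simp add: fun_eq_iff D_def h_def k_def c_s_def algebra_simps)
  moreover have "D z (\<i> * w) = qmul (normalN \<beta>0 z) (D z w)" for z w
  proof -
    define C S where "C = complex_of_real (cos (2 * (pi * (\<beta>0 \<bullet> z))))" "S = complex_of_real (sin (2 * (pi * (\<beta>0 \<bullet> z))))"
    have rel: "c z * C + s z * S = c z" "c z * S - s z * C = s z"
      unfolding c_s_def C_S_def by (rule double_angle_combinations)+
    have hk1: "h z \<i> = \<i> * h z 1" "k z \<i> = - \<i> * k z 1"
      using eq[of z] unfolding h_def k_def
      by (simp_all add: complex_eq_iff inner_complex_def algebra_simps)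
    have lin: "h z w = Re w * h z 1 + Im w * h z \<i>" "k z w = Re w * k z 1 + Im w * k z \<i>" for w
    proof -
      interpret u: bounded_linear "Du z" using Du has_derivative_bounded_linear by blast
      interpret v: bounded_linear "Dv z" using Dv has_derivative_bounded_linear by blast
      have w: "w = Re w *\<^sub>R 1 + Im w *\<^sub>R \<i>" by (simp add: complex_eq_iff)
      have "Du z w = Re w * Du z 1 + Im w * Du z \<i>" "Dv z w = Re w * Dv z 1 + Im w * Dv z \<i>"
        using arg_cong[OF w, of "Du z"] arg_cong[OF w, of "Dv z"]
        unfolding u.add u.scaleR v.add v.scaleR by (simp_all only: scaleR_conv_of_real)
      moreover have "\<beta>0 \<bullet> w = Re w * (\<beta>0 \<bullet> 1) + Im w * (\<beta>0 \<bullet> \<i>)" by (simp add: inner_complex_def)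
      ultimately show "h z w = Re w * h z 1 + Im w * h z \<i>" "k z w = Re w * k z 1 + Im w * k z \<i>"
        by (simp_all add: h_def k_def algebra_simps)
    qed
    have hk: "h z (\<i> * w) = \<i> * h z w" "k z (\<i> * w) = - \<i> * k z w"
      unfolding lin[of "\<i> * w"] lin[of w] hk1 by (simp_all add: algebra_simps)
    have real: "cnj (c z) = c z" "cnj (s z) = s z" "cnj C = C" "cnj S = S" by (simp_all add: c_s_def C_S_def)
    have "C * (c z * h z w - s z * k z w) + S * (s z * h z w + c z * k z w)
      = (c z * C + s z * S) * h z w + (c z * S - s z * C) * k z w" by (simp add: algebra_simps)
    then have 1: "C * (c z * h z w - s z * k z w) + S * (s z * h z w + c z * k z w) = c z * h z w + s z * k z w"
      unfolding rel .
    have "S * (c z * h z w - s z * k z w) - C * (s z * h z w + c z * k z w)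
      = (c z * S - s z * C) * h z w - (c z * C + s z * S) * k z w" by (simp add: algebra_simps)
    then have 2: "S * (c z * h z w - s z * k z w) - C * (s z * h z w + c z * k z w) = s z * h z w - c z * k z w"
      unfolding rel .
    have "qmul (normalN \<beta>0 z) (D z w) =
       (\<i> * (C * (c z * h z w - s z * k z w) + S * (s z * h z w + c z * k z w)),
        cnj (\<i> * (S * (c z * h z w - s z * k z w) - C * (s z * h z w + c z * k z w))))"
      unfolding D_def normalN_mult C_S_def[symmetric] by (simp add: real algebra_simps)
    also have "\<dots> = D z (\<i> * w)"
      unfolding 1 2 D_def hk by (simp add: algebra_simps)
    finally show ?thesis by simp
  qed
  ultimately show ?thesis unfolding holomorphic_q_def by blast
qed

text \<open>A lattice translation changes the half angle by an integer multiple of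
  \<open>pi\<close>, hence both functions by the same sign. This sign is the source of the shift by
  \<open>\<beta>0/2\<close> in \<open>dual_AB\<close>.\<close>

lemma angle_translate:
  assumes "\<beta>0 \<bullet> \<gamma> \<in> \<int>"
  shows "cos_half \<beta>0 (z + \<gamma>) = wave 0 (\<beta>0/2) \<gamma> * cos_half \<beta>0 z"
    "sin_half \<beta>0 (z + \<gamma>) = wave 0 (\<beta>0/2) \<gamma> * sin_half \<beta>0 z"
proof -
  obtain k :: int where k: "\<beta>0 \<bullet> \<gamma> = k" using assms by (auto elim: Ints_cases)
  have s: "sin (pi * k) = 0" by (simp add: mult.commute)
  have half: "2 * pi * ((\<beta>0/2) \<bullet> \<gamma>) = pi * k" by (simp add: inner_complex_def flip: k)
  have "wave 0 (\<beta>0/2) \<gamma> = cis (pi * k)" unfolding wave_def half by (simp add: cis_conv_exp)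
  then have w: "wave 0 (\<beta>0/2) \<gamma> = cos (pi * k)" using s by (simp add: complex_eq_iff)
  have "pi * (\<beta>0 \<bullet> (z + \<gamma>)) = pi * (\<beta>0 \<bullet> z) + pi * k" by (simp add: inner_add_right k algebra_simps)
  then show "cos_half \<beta>0 (z + \<gamma>) = wave 0 (\<beta>0/2) \<gamma> * cos_half \<beta>0 z"
    "sin_half \<beta>0 (z + \<gamma>) = wave 0 (\<beta>0/2) \<gamma> * sin_half \<beta>0 z"
    using s by (simp_all add: cos_add sin_add w)
qed

lemma inner_cmult_unit:
  "complex_of_real (A \<bullet> 1) + \<i> * (A \<bullet> \<i>) = A" "complex_of_real (A \<bullet> 1) - \<i> * (A \<bullet> \<i>) = cnj A"
  by (simp_all add: complex_eq_iff inner_complex_def)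

text \<open>The left side equals \<open>4 * ((cmod A)\<^sup>2 - (cmod E)\<^sup>2) + 8 * \<i> * (E
  \<bullet> A)\<close>; the two conditions are its real and imaginary parts. The equation is the
  vanishing determinant of the linear system for one frequency.\<close>

lemma symbol_det:
  fixes A E \<beta> :: complex
  shows "4 * (cnj A + \<i> * cnj E) * (A + \<i> * E) = - (\<beta> * cnj \<beta>) \<longleftrightarrow>
      (cmod E)\<^sup>2 - (cmod A)\<^sup>2 = (cmod \<beta>)\<^sup>2 / 4 \<and> E \<bullet> A = 0"
  unfolding cmod_power2 by (auto simp: complex_eq_iff inner_complex_def power2_eq_square algebra_simps)

section \<open>Vanishing of sections without resonant frequency and explicit sections\<close>

context complex_lattice
begin

text \<open>Pairing both Dirac equations with the inverse wave and integrating by parts gives two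
  linear equations for the coefficients \<open>p\<close> and \<open>q\<close>. Since
  \<open>d + \<beta>0/2\<close> is not in \<open>dual_AB\<close>, the determinant is
  nonzero.\<close>

lemma dirac_pair_coefficient:
  assumes "dirac_pair \<beta>0 u v"
    and u: "\<And>z \<gamma>. \<gamma> \<in> \<Gamma> \<Longrightarrow> u (z + \<gamma>) = wave A (\<beta>0/2 - B) \<gamma> * u z"
    and v: "\<And>z \<gamma>. \<gamma> \<in> \<Gamma> \<Longrightarrow> v (z + \<gamma>) = wave A (\<beta>0/2 - B) \<gamma> * v z"
    and \<beta>0: "\<beta>0 \<noteq> 0" and empty: "dual_AB \<Gamma> \<beta>0 A B = {}" and d: "d \<in> dual_lattice \<Gamma>"
  defines "E \<equiv> d + \<beta>0/2 - B"
  shows "((\<lambda>x. u (emb x) * wave (-A) (-E) (emb x)) has_integral 0) unit_square"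
    "((\<lambda>x. v (emb x) * wave (-A) (-E) (emb x)) has_integral 0) unit_square"
proof -
  obtain Du Dv where Du: "\<And>z. (u has_derivative Du z) (at z)" and Dv: "\<And>z. (v has_derivative Dv z) (at z)"
    and eq: "\<And>z. Du z 1 + \<i> * Du z \<i> = of_real pi * \<beta>0 * v z" "\<And>z. Dv z 1 - \<i> * Dv z \<i> = - (of_real pi * cnj \<beta>0 * u z)"
    using assms unfolding dirac_pair_def by blast
  let ?w = "wave (-A) (-E)"
  have cont: "continuous_on UNIV u" "continuous_on UNIV v"
    using Du Dv by (meson continuous_at_imp_continuous_on has_derivative_continuous)+
  have ci: "(\<lambda>x. f (emb x)) integrable_on unit_square" if "continuous_on UNIV f" for f :: "complex \<Rightarrow> complex"
    by (intro integrable_continuous continuous_on_compose2[OF that continuous_on_emb]) auto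
  define p where "p = integral unit_square (\<lambda>x. u (emb x) * ?w (emb x))"
  define q where "q = integral unit_square (\<lambda>x. v (emb x) * ?w (emb x))"
  have p: "((\<lambda>x. u (emb x) * ?w (emb x)) has_integral p) unit_square"
    unfolding p_def using ci[of "\<lambda>z. u z * ?w z"]
    by (intro integrable_integral) (auto intro!: continuous_intros cont)
  have q: "((\<lambda>x. v (emb x) * ?w (emb x)) has_integral q) unit_square"
    unfolding q_def using ci[of "\<lambda>z. v z * ?w z"]
    by (intro integrable_integral) (auto intro!: continuous_intros cont)
  \<comment> \<open>The growths cancel and the frequencies add up to \<open>-d\<close>, which is
    dual, so the products with \<open>?w\<close> are periodic.\<close>
  have per: "wave A (\<beta>0/2 - B) \<gamma> * ?w \<gamma> = 1" if "\<gamma> \<in> \<Gamma>" for \<gamma>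
    unfolding wave_mult using that d
    by (auto intro!: wave_eq_1 simp: E_def dual_lattice_def)
  have "((\<lambda>x. pi * (\<beta>0 * (v (emb x) * ?w (emb x)) - 2 * (A + \<i> * E) * (u (emb x) * ?w (emb x)))) has_integral 0) unit_square"
  proof (rule periodic_mean_0[where G = "\<lambda>z. of_real pi * (\<beta>0 * (v z * ?w z) - 2 * (A + \<i> * E) * (u z * ?w z))"])
    fix z
    show "((\<lambda>z. u z * ?w z) has_derivative (\<lambda>w. u z * (?w z * (2 * pi * (-A \<bullet> w) + \<i> * (2 * pi * (-E \<bullet> w)))) + Du z w * ?w z)) (at z)"
      by (intro has_derivative_mult Du wave_has_derivative)
    show "u z * (?w z * (2 * pi * (-A \<bullet> 1) + \<i> * (2 * pi * (-E \<bullet> 1)))) + Du z 1 * ?w z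
       + \<i> * (u z * (?w z * (2 * pi * (-A \<bullet> \<i>) + \<i> * (2 * pi * (-E \<bullet> \<i>)))) + Du z \<i> * ?w z)
       = pi * (\<beta>0 * (v z * ?w z) - 2 * (A + \<i> * E) * (u z * ?w z))" (is "?l = _")
    proof -
      have "?l = (Du z 1 + \<i> * Du z \<i>) * ?w z - 2 * pi * (u z * ?w z) *
         ((complex_of_real (A \<bullet> 1) + \<i> * (A \<bullet> \<i>)) + \<i> * (complex_of_real (E \<bullet> 1) + \<i> * (E \<bullet> \<i>)))"
        by (simp add: algebra_simps)
      then show ?thesis unfolding eq inner_cmult_unit by (simp add: algebra_simps)
    qed
    show "u (z + \<gamma>) * ?w (z + \<gamma>) = u z * ?w z" if "\<gamma> \<in> \<Gamma>" for \<gamma>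
      using per[OF that] by (simp add: u[OF that] wave_add)
  qed (auto intro!: continuous_intros cont)
  moreover have "((\<lambda>x. pi * (\<beta>0 * (v (emb x) * ?w (emb x)) - 2 * (A + \<i> * E) * (u (emb x) * ?w (emb x))))
      has_integral pi * (\<beta>0 * q - 2 * (A + \<i> * E) * p)) unit_square"
    by (intro has_integral_mult_right has_integral_diff p q)
  ultimately have "of_real pi * (\<beta>0 * q - 2 * (A + \<i> * E) * p) = 0" by (rule has_integral_unique[symmetric])
  then have 1: "\<beta>0 * q = 2 * (A + \<i> * E) * p" by simp
  \<comment> \<open>The equation for \<open>v\<close> contains the holomorphic derivative, hence
    \<open>\<kappa> = -\<i>\<close> and conjugated symbols.\<close>
  have "((\<lambda>x. - (pi * (cnj \<beta>0 * (u (emb x) * ?w (emb x)) + 2 * (cnj A + \<i> * cnj E) * (v (emb x) * ?w (emb x))))) has_integral 0) unit_square"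
  proof (rule periodic_mean_0[where \<kappa> = "-\<i>" and
      G = "\<lambda>z. - (of_real pi * (cnj \<beta>0 * (u z * ?w z) + 2 * (cnj A + \<i> * cnj E) * (v z * ?w z)))"])
    fix z
    show "((\<lambda>z. v z * ?w z) has_derivative (\<lambda>w. v z * (?w z * (2 * pi * (-A \<bullet> w) + \<i> * (2 * pi * (-E \<bullet> w)))) + Dv z w * ?w z)) (at z)"
      by (intro has_derivative_mult Dv wave_has_derivative)
    show "v z * (?w z * (2 * pi * (-A \<bullet> 1) + \<i> * (2 * pi * (-E \<bullet> 1)))) + Dv z 1 * ?w z
       + - \<i> * (v z * (?w z * (2 * pi * (-A \<bullet> \<i>) + \<i> * (2 * pi * (-E \<bullet> \<i>)))) + Dv z \<i> * ?w z)
       = - (pi * (cnj \<beta>0 * (u z * ?w z) + 2 * (cnj A + \<i> * cnj E) * (v z * ?w z)))" (is "?l = _")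
    proof -
      have "?l = (Dv z 1 - \<i> * Dv z \<i>) * ?w z - 2 * pi * (v z * ?w z) *
         ((complex_of_real (A \<bullet> 1) - \<i> * (A \<bullet> \<i>)) + \<i> * (complex_of_real (E \<bullet> 1) - \<i> * (E \<bullet> \<i>)))"
        by (simp add: algebra_simps)
      then show ?thesis unfolding eq inner_cmult_unit by (simp add: algebra_simps)
    qed
    show "v (z + \<gamma>) * ?w (z + \<gamma>) = v z * ?w z" if "\<gamma> \<in> \<Gamma>" for \<gamma>
      using per[OF that] by (simp add: v[OF that] wave_add)
  qed (auto intro!: continuous_intros cont)
  moreover have "((\<lambda>x. - (pi * (cnj \<beta>0 * (u (emb x) * ?w (emb x)) + 2 * (cnj A + \<i> * cnj E) * (v (emb x) * ?w (emb x)))))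
      has_integral - (pi * (cnj \<beta>0 * p + 2 * (cnj A + \<i> * cnj E) * q))) unit_square"
    by (intro has_integral_neg has_integral_mult_right has_integral_add p q)
  ultimately have "- (pi * (cnj \<beta>0 * p + 2 * (cnj A + \<i> * cnj E) * q)) = 0" by (rule has_integral_unique[symmetric])
  then have 2: "cnj \<beta>0 * p = - (2 * (cnj A + \<i> * cnj E) * q)" by (simp add: add_eq_0_iff2)
  have "d + \<beta>0/2 \<notin> dual_AB \<Gamma> \<beta>0 A B" using empty by simp
  then have "4 * (cnj A + \<i> * cnj E) * (A + \<i> * E) \<noteq> - (\<beta>0 * cnj \<beta>0)"
    unfolding symbol_det using d by (auto simp: dual_AB_def E_def)
  \<comment> \<open>Elimination of \<open>q\<close> between the two equations.\<close>
  moreover have "\<beta>0 * cnj \<beta>0 * p = - (4 * (cnj A + \<i> * cnj E) * (A + \<i> * E)) * p"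
  proof -
    have "\<beta>0 * cnj \<beta>0 * p = - (2 * (cnj A + \<i> * cnj E) * (\<beta>0 * q))" using 2 by (simp add: mult.assoc)
    then show ?thesis unfolding 1 by (simp add: algebra_simps)
  qed
  ultimately have p0: "p = 0" by (metis minus_minus mult_cancel_right)
  then have "q = 0" using 1 \<beta>0 by simp
  with p q p0 show "((\<lambda>x. u (emb x) * ?w (emb x)) has_integral 0) unit_square"
    "((\<lambda>x. v (emb x) * ?w (emb x)) has_integral 0) unit_square" by simp_all
qed

text \<open>Division by the common wave factor makes \<open>u\<close> and \<open>v\<close> periodic,
  and all their coefficients vanish by the preceding lemma.\<close>

lemma dirac_pair_eq_0:
  assumes dp: "dirac_pair \<beta>0 u v"
    and u: "\<And>z \<gamma>. \<gamma> \<in> \<Gamma> \<Longrightarrow> u (z + \<gamma>) = wave A (\<beta>0/2 - B) \<gamma> * u z"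
    and v: "\<And>z \<gamma>. \<gamma> \<in> \<Gamma> \<Longrightarrow> v (z + \<gamma>) = wave A (\<beta>0/2 - B) \<gamma> * v z"
    and \<beta>0: "\<beta>0 \<noteq> 0" and empty: "dual_AB \<Gamma> \<beta>0 A B = {}"
  shows "u z = 0 \<and> v z = 0"
proof -
  let ?w = "wave (-A) (- (\<beta>0/2 - B))"
  have cont: "continuous_on UNIV u" "continuous_on UNIV v"
    using dp unfolding dirac_pair_def
    by (meson continuous_at_imp_continuous_on has_derivative_continuous)+
  have per: "wave A (\<beta>0/2 - B) \<gamma> * ?w \<gamma> = 1" for \<gamma> by (simp add: wave_mult)
  \<comment> \<open>Pairing with the character of \<open>d\<close> is the coefficient belonging to
    \<open>-d\<close>, because the test wave carries the opposite frequency.\<close>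
  have shift: "?w y * wave 0 d y = wave (-A) (- (- d + \<beta>0/2 - B)) y" for d y
    by (simp add: wave_mult algebra_simps)
  have neg: "- d \<in> dual_lattice \<Gamma>" if "d \<in> dual_lattice \<Gamma>" for d
    using that by (simp add: dual_lattice_def)
  have "u z * ?w z = 0"
  proof (rule periodic_eq_0[where P = "\<lambda>z. u z * ?w z"])
    show "u (z + \<gamma>) * ?w (z + \<gamma>) = u z * ?w z" if "\<gamma> \<in> \<Gamma>" for z \<gamma>
      using per[of \<gamma>] by (simp add: u[OF that] wave_add)
    show "((\<lambda>x. u (emb x) * ?w (emb x) * wave 0 d (emb x)) has_integral 0) unit_square"
      if "d \<in> dual_lattice \<Gamma>" for d
      using dirac_pair_coefficient(1)[OF dp u v \<beta>0 empty neg[OF that]] unfolding mult.assoc shift .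
  qed (intro continuous_intros cont)
  moreover have "v z * ?w z = 0"
  proof (rule periodic_eq_0[where P = "\<lambda>z. v z * ?w z"])
    show "v (z + \<gamma>) * ?w (z + \<gamma>) = v z * ?w z" if "\<gamma> \<in> \<Gamma>" for z \<gamma>
      using per[of \<gamma>] by (simp add: v[OF that] wave_add)
    show "((\<lambda>x. v (emb x) * ?w (emb x) * wave 0 d (emb x)) has_integral 0) unit_square"
      if "d \<in> dual_lattice \<Gamma>" for d
      using dirac_pair_coefficient(2)[OF dp u v \<beta>0 empty neg[OF that]] unfolding mult.assoc shift .
  qed (intro continuous_intros cont)
  ultimately show ?thesis by simp
qed

text \<open>Both rotated components inherit the multiplier times the sign of the half angle, so the
  vanishing result for Dirac pairs applies to them.\<close>

lemma H0_eq_0: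
  assumes \<alpha>: "\<alpha> \<in> H0 \<Gamma> \<beta>0 h" and h: "\<And>\<gamma>. \<gamma> \<in> \<Gamma> \<Longrightarrow> h \<gamma> = hAB A B \<gamma>"
    and \<beta>0: "\<beta>0 \<noteq> 0" "\<beta>0 \<in> dual_lattice \<Gamma>" and empty: "dual_AB \<Gamma> \<beta>0 A B = {}"
  shows "\<alpha> z = 0"
proof -
  \<comment> \<open>Moving a complex scalar past \<open>j\<close> conjugates it; conjugating the
    second component undoes this.\<close>
  have per: "fst (\<alpha> (z + \<gamma>)) = fst (\<alpha> z) * hAB A B \<gamma>" "cnj (snd (\<alpha> (z + \<gamma>))) = cnj (snd (\<alpha> z)) * hAB A B \<gamma>"
    if "\<gamma> \<in> \<Gamma>" for z \<gamma>
    using \<alpha> that h by (simp_all add: H0_def qmul_def cq_def)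
  have w: "wave A (\<beta>0/2 - B) \<gamma> = wave 0 (\<beta>0/2) \<gamma> * hAB A B \<gamma>" for \<gamma>
    by (simp add: hAB_eq_wave wave_mult)
  have int: "\<beta>0 \<bullet> \<gamma> \<in> \<int>" if "\<gamma> \<in> \<Gamma>" for \<gamma> using \<beta>0 that by (simp add: dual_lattice_def)
  have "dirac_pair \<beta>0 (rotate_re \<beta>0 \<alpha>) (rotate_j \<beta>0 \<alpha>)"
    using \<alpha> by (intro dirac_pair_rotate) (simp add: H0_def)
  moreover have "rotate_re \<beta>0 \<alpha> (z + \<gamma>) = wave A (\<beta>0/2 - B) \<gamma> * rotate_re \<beta>0 \<alpha> z"
    "rotate_j \<beta>0 \<alpha> (z + \<gamma>) = wave A (\<beta>0/2 - B) \<gamma> * rotate_j \<beta>0 \<alpha> z" if "\<gamma> \<in> \<Gamma>" for z \<gamma>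
    unfolding rotate_re_def rotate_j_def per[OF that] angle_translate[OF int[OF that]] w
    by (simp_all add: algebra_simps)
  ultimately have "rotate_re \<beta>0 \<alpha> z = 0 \<and> rotate_j \<beta>0 \<alpha> z = 0"
    by (rule dirac_pair_eq_0[OF _ _ _ \<beta>0(1) empty])
  then show ?thesis using rotate_eq_0_imp by blast
qed

text \<open>A resonant frequency makes the linear system singular, and a kernel vector times the
  wave solves the Dirac system.\<close>

lemma ex_section_line:
  assumes \<beta>0: "\<beta>0 \<noteq> 0" "\<beta>0 \<in> dual_lattice \<Gamma>" and \<delta>: "\<delta> \<in> dual_AB \<Gamma> \<beta>0 A B"
  shows "\<exists>\<alpha>. \<alpha> \<noteq> (\<lambda>_. 0) \<and> (\<forall>c. (\<lambda>z. qmul (\<alpha> z) (cq c)) \<in> H0 \<Gamma> \<beta>0 (hAB A B))"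
proof -
  define E where "E = \<delta> - B"
  have det: "4 * (cnj A + \<i> * cnj E) * (A + \<i> * E) = - (\<beta>0 * cnj \<beta>0)"
    unfolding symbol_det using \<delta> by (simp add: dual_AB_def E_def)
  obtain d where d: "d \<in> dual_lattice \<Gamma>" "\<delta> = d + \<beta>0/2" using \<delta> by (auto simp: dual_AB_def)
  \<comment> \<open>\<open>(\<beta>0, 2 * (A + \<i> * E))\<close> solves the first equation by
    construction and the second by \<open>det\<close>. The factor \<open>c\<close> will be the right
    scalar.\<close>
  define U V where "U c z = c * \<beta>0 * wave A E z" "V c z = c * 2 * (A + \<i> * E) * wave A E z" for c z
  define \<alpha> where "\<alpha> c = unrotate \<beta>0 (U c) (V c)" for c
  have dp: "dirac_pair \<beta>0 (U c) (V c)" for c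
    unfolding dirac_pair_def
  proof (intro exI allI conjI)
    let ?D = "\<lambda>z w. wave A E z * (2 * pi * (A \<bullet> w) + \<i> * (2 * pi * (E \<bullet> w)))"
    fix z
    show "(U c has_derivative (\<lambda>w. c * \<beta>0 * ?D z w)) (at z)"
      "(V c has_derivative (\<lambda>w. c * 2 * (A + \<i> * E) * ?D z w)) (at z)"
      unfolding U_V_def by (intro has_derivative_mult_right wave_has_derivative)+
    have "?D z 1 + \<i> * ?D z \<i> = 2 * pi * wave A E z *
       ((complex_of_real (A \<bullet> 1) + \<i> * (A \<bullet> \<i>)) + \<i> * (complex_of_real (E \<bullet> 1) + \<i> * (E \<bullet> \<i>)))"
      by (simp add: algebra_simps)
    then have 1: "?D z 1 + \<i> * ?D z \<i> = 2 * pi * wave A E z * (A + \<i> * E)" unfolding inner_cmult_unit .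
    have "?D z 1 - \<i> * ?D z \<i> = 2 * pi * wave A E z *
       ((complex_of_real (A \<bullet> 1) - \<i> * (A \<bullet> \<i>)) + \<i> * (complex_of_real (E \<bullet> 1) - \<i> * (E \<bullet> \<i>)))"
      by (simp add: algebra_simps)
    then have 2: "?D z 1 - \<i> * ?D z \<i> = 2 * pi * wave A E z * (cnj A + \<i> * cnj E)" unfolding inner_cmult_unit .
    have "c * \<beta>0 * ?D z 1 + \<i> * (c * \<beta>0 * ?D z \<i>) = c * \<beta>0 * (?D z 1 + \<i> * ?D z \<i>)"
      by (simp only: distrib_left mult.assoc mult.left_commute)
    also have "\<dots> = of_real pi * \<beta>0 * V c z" unfolding 1 U_V_def by (simp add: mult_ac)
    finally show "c * \<beta>0 * ?D z 1 + \<i> * (c * \<beta>0 * ?D z \<i>) = of_real pi * \<beta>0 * V c z" .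
    have "c * 2 * (A + \<i> * E) * ?D z 1 - \<i> * (c * 2 * (A + \<i> * E) * ?D z \<i>)
        = c * 2 * (A + \<i> * E) * (?D z 1 - \<i> * ?D z \<i>)"
      by (simp only: right_diff_distrib mult.assoc mult.left_commute)
    also have "\<dots> = c * pi * wave A E z * (4 * (cnj A + \<i> * cnj E) * (A + \<i> * E))"
      unfolding 2 by (simp add: algebra_simps)
    also have "\<dots> = - (of_real pi * cnj \<beta>0 * U c z)" unfolding det U_V_def by (simp add: mult_ac)
    finally show "c * 2 * (A + \<i> * E) * ?D z 1 - \<i> * (c * 2 * (A + \<i> * E) * ?D z \<i>)
        = - (of_real pi * cnj \<beta>0 * U c z)" .
  qed
  have int: "\<beta>0 \<bullet> \<gamma> \<in> \<int>" if "\<gamma> \<in> \<Gamma>" for \<gamma> using \<beta>0 that by (simp add: dual_lattice_def)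
  have w: "wave 0 (\<beta>0/2) \<gamma> * wave A E \<gamma> = hAB A B \<gamma>" if "\<gamma> \<in> \<Gamma>" for \<gamma>
  proof -
    have "wave 0 (d + \<beta>0) \<gamma> = 1"
      using that d \<beta>0(2) by (intro wave_eq_1) (auto simp: dual_lattice_def inner_add_left)
    \<comment> \<open>The half period in \<delta> and the one from the rotation combine to the dual
      vector \<open>\<beta>0\<close>, so only \<open>-B\<close> is seen by \<Gamma>.\<close>
    moreover have E: "\<beta>0/2 + E = d + \<beta>0 + - B" by (simp add: E_def d field_simps)
    have "wave 0 (\<beta>0/2) \<gamma> * wave A E \<gamma> = wave 0 (d + \<beta>0) \<gamma> * wave A (-B) \<gamma>"
      unfolding wave_mult E by simp
    ultimately show ?thesis by (simp add: hAB_eq_wave)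
  qed
  have "\<alpha> c (z + \<gamma>) = qmul (\<alpha> c z) (cq (hAB A B \<gamma>))" if "\<gamma> \<in> \<Gamma>" for c z \<gamma>
    unfolding w[OF that, symmetric] \<alpha>_def unrotate_def U_V_def angle_translate[OF int[OF that]] wave_add
    by (simp add: qmul_def cq_def algebra_simps)
  then have mem: "\<alpha> c \<in> H0 \<Gamma> \<beta>0 (hAB A B)" for c
    using holomorphic_unrotate[OF dp] by (simp add: H0_def \<alpha>_def)
  have scale: "(\<lambda>z. qmul (\<alpha> 1 z) (cq c)) = \<alpha> c" for c
    by (simp add: fun_eq_iff \<alpha>_def unrotate_def U_V_def qmul_def cq_def algebra_simps)
  \<comment> \<open>At the origin the rotation is trivial and the first component is
    \<open>\<beta>0\<close>.\<close>
  have "\<alpha> 1 0 \<noteq> 0" using \<beta>0(1) by (simp add: \<alpha>_def unrotate_def U_V_def zero_prod_def)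
  then have "\<alpha> 1 \<noteq> (\<lambda>_. 0)" by metis
  then show ?thesis using mem scale by metis
qed

end

section \<open>The multiplier spectrum of a Hamiltonian stationary torus\<close>

theorem theorem2p2:
  fixes \<Gamma> :: "complex set" and \<beta>0 :: complex and f :: "complex \<Rightarrow> quat"
  assumes "HS_torus \<Gamma> \<beta>0 f"
  shows "(\<forall>h. in_Spec \<Gamma> \<beta>0 h \<longrightarrow>
            (\<exists>A B. (\<forall>\<gamma>\<in>\<Gamma>. hAB A B \<gamma> = h \<gamma>) \<and>
               (\<forall>A' B'. (\<forall>\<gamma>\<in>\<Gamma>. hAB A' B' \<gamma> = h \<gamma>) \<longleftrightarrow>
                        (A' = A \<and> B' - B \<in> dual_lattice \<Gamma>))))
       \<and> (\<forall>h. lattice_hom \<Gamma> h \<longrightarrow>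
            (in_Spec \<Gamma> \<beta>0 h \<longleftrightarrow>
             (\<exists>A B. (\<forall>\<gamma>\<in>\<Gamma>. h \<gamma> = hAB A B \<gamma>) \<and> dual_AB \<Gamma> \<beta>0 A B \<noteq> {})))
       \<and> (\<forall>A B. \<forall>\<delta>\<in>dual_AB \<Gamma> \<beta>0 A B.
            \<exists>L. L \<subseteq> H0 \<Gamma> \<beta>0 (hAB A B) \<and> one_dim_subspace L)"
proof -
  have \<beta>0: "\<beta>0 \<noteq> 0" "\<beta>0 \<in> dual_lattice \<Gamma>" and "lattice \<Gamma>" using assms by (auto simp: HS_torus_def)
  then obtain \<omega>1 \<omega>2 where "complex_lattice \<omega>1 \<omega>2 \<Gamma>"
    unfolding lattice_def complex_lattice_def by blast
  then interpret complex_lattice \<omega>1 \<omega>2 \<Gamma> .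
  have unique: "\<exists>A B. (\<forall>\<gamma>\<in>\<Gamma>. hAB A B \<gamma> = h \<gamma>) \<and>
     (\<forall>A' B'. (\<forall>\<gamma>\<in>\<Gamma>. hAB A' B' \<gamma> = h \<gamma>) \<longleftrightarrow> (A' = A \<and> B' - B \<in> dual_lattice \<Gamma>))"
    if "in_Spec \<Gamma> \<beta>0 h" for h
  proof -
    have "lattice_hom \<Gamma> h" using that by (simp add: in_Spec_def)
    then obtain A B where AB: "\<And>\<gamma>. \<gamma> \<in> \<Gamma> \<Longrightarrow> h \<gamma> = hAB A B \<gamma>" using hom_eq_hAB by blast
    then have "(\<forall>\<gamma>\<in>\<Gamma>. hAB A' B' \<gamma> = h \<gamma>) \<longleftrightarrow> (A' = A \<and> B' - B \<in> dual_lattice \<Gamma>)" for A' B'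
      unfolding hAB_eq_iff[symmetric] by simp
    with AB show ?thesis by metis
  qed
  have spec: "in_Spec \<Gamma> \<beta>0 h \<longleftrightarrow> (\<exists>A B. (\<forall>\<gamma>\<in>\<Gamma>. h \<gamma> = hAB A B \<gamma>) \<and> dual_AB \<Gamma> \<beta>0 A B \<noteq> {})"
    if h: "lattice_hom \<Gamma> h" for h
  proof
    assume "in_Spec \<Gamma> \<beta>0 h"
    then obtain \<alpha> where \<alpha>: "\<alpha> \<in> H0 \<Gamma> \<beta>0 h" "\<alpha> \<noteq> (\<lambda>_. 0)" by (auto simp: in_Spec_def)
    obtain A B where AB: "\<And>\<gamma>. \<gamma> \<in> \<Gamma> \<Longrightarrow> h \<gamma> = hAB A B \<gamma>" using hom_eq_hAB[OF h] by blast
    \<comment> \<open>Any pair representing \<open>h\<close> works: an empty frequency set would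
      force \<alpha> to vanish identically.\<close>
    with \<alpha> \<beta>0 have "dual_AB \<Gamma> \<beta>0 A B \<noteq> {}" using H0_eq_0[OF \<alpha>(1) AB \<beta>0] by (metis ext)
    with AB show "\<exists>A B. (\<forall>\<gamma>\<in>\<Gamma>. h \<gamma> = hAB A B \<gamma>) \<and> dual_AB \<Gamma> \<beta>0 A B \<noteq> {}" by blast
  next
    assume "\<exists>A B. (\<forall>\<gamma>\<in>\<Gamma>. h \<gamma> = hAB A B \<gamma>) \<and> dual_AB \<Gamma> \<beta>0 A B \<noteq> {}"
    then obtain A B \<delta> where AB: "\<And>\<gamma>. \<gamma> \<in> \<Gamma> \<Longrightarrow> h \<gamma> = hAB A B \<gamma>" and \<delta>: "\<delta> \<in> dual_AB \<Gamma> \<beta>0 A B"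
      by blast
    obtain \<alpha> where \<alpha>: "\<alpha> \<noteq> (\<lambda>_. 0)" "\<And>c. (\<lambda>z. qmul (\<alpha> z) (cq c)) \<in> H0 \<Gamma> \<beta>0 (hAB A B)"
      using ex_section_line[OF \<beta>0 \<delta>] by blast
    \<comment> \<open>The scalar 1 recovers the generator of the line itself.\<close>
    have "(\<lambda>z. qmul (\<alpha> z) (cq 1)) = \<alpha>" by (simp add: fun_eq_iff qmul_def cq_def)
    with \<alpha>(2)[of 1] have "\<alpha> \<in> H0 \<Gamma> \<beta>0 h" by (simp add: H0_def AB)
    with \<alpha>(1) h show "in_Spec \<Gamma> \<beta>0 h" by (auto simp: in_Spec_def)
  qed
  have line: "\<exists>L. L \<subseteq> H0 \<Gamma> \<beta>0 (hAB A B) \<and> one_dim_subspace L" if \<delta>: "\<delta> \<in> dual_AB \<Gamma> \<beta>0 A B" for A B \<delta>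
  proof -
    obtain \<alpha> where \<alpha>: "\<alpha> \<noteq> (\<lambda>_. 0)" "\<And>c. (\<lambda>z. qmul (\<alpha> z) (cq c)) \<in> H0 \<Gamma> \<beta>0 (hAB A B)"
      using ex_section_line[OF \<beta>0 \<delta>] by blast
    show ?thesis
    proof (intro exI conjI)
      show "{(\<lambda>z. qmul (\<alpha> z) (cq c)) | c. True} \<subseteq> H0 \<Gamma> \<beta>0 (hAB A B)" using \<alpha>(2) by blast
      show "one_dim_subspace {(\<lambda>z. qmul (\<alpha> z) (cq c)) | c. True}"
        unfolding one_dim_subspace_def using \<alpha>(1) by blast
    qed
  qed
  show ?thesis
    by (intro conjI allI impI ballI unique spec line)
qed

end
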